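(* Let $\mathcal I\subseteq\mathbb C[\underline z]$ be a polynomial ideal, let $[\mathcal I]$ be a completion of $\mathcal I$ which is a Hilbert module in the class $\mathfrak B_1(\Omega^* )$, and let $K$ be its reproducing kernel. Fix $w_0\in\Omega$ and polynomials $q_1,\ldots,q_t\in\mathbb C[\underline z]$. Then the vectors $$q_1^*(\bar D)K(\cdot,w)|_{w=w_0},\ \ldots,\ q_t^*(\bar D)K(\cdot,w)|_{w=w_0}$$ form a basis of the joint kernel $\bigcap_{j=1}^m\ker(M_j-w_{0j})^*$ if and only if the classes $[q_1],\ldots,[q_t]$ form a basis of the quotient space $\tilde{\mathbb V}_{w_0}(\mathcal I)/\mathbb V_{w_0}(\mathcal I)$ (in particular $q_1,\ldots,q_t\in\tilde{\mathbb V}_{w_0}(\mathcal I)$).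
   Context: $\Omega\subset\mathbb C^m$ is a bounded domain, $\Omega^*=\{\bar z:z\in\Omega\}$, and $\mathbb C[\underline z]=\mathbb C[z_1,\ldots,z_m]$. Hilbert modules here are Hilbert spaces $\mathcal M$ of holomorphic functions on $\Omega$ on which multiplication $M_j$ by each coordinate function $z_j$ is a bounded operator; $M_j^*$ is its adjoint on $\mathcal M$. For $w\in\mathbb C^m$, $\mathfrak m_w$ is the maximal ideal of $\mathbb C[\underline z]$ at $w$. The Hilbert module $\mathcal M$ is in the class $\mathfrak B_1(\Omega^* )$ if it possesses a reproducing kernel $K$ (it is allowed that $K(w,w)=0$ on some closed subset of $\Omega$) and $\dim\mathcal M/\mathfrak m_w\mathcal M<\infty$ for all $w\in\Omega$. $[\mathcal I]$ denotes a Hilbert module containing $\mathcal I$ as a dense subspace (the completion of $\mathcal I$ with respect to some inner product). For $q=\sum_\alpha a_\alpha z^\alpha$ put $q(D)=\sum_\alpha a_\alpha\partial^\alpha$ with $\partial^\alpha=\partial^{|\alpha|}/\partial z_1^{\alpha_1}\cdots\partial z_m^{\alpha_m}$, and $q^*(z)=\overline{q(\bar z)}=\sum_\alpha\bar a_\alpha z^\alpha$. Also $q(\bar D)=\sum_\alpha a_\alpha\bar\partial^\alpha$, where $\bar\partial^\alpha=\partial^{|\alpha|}/\partial\bar w_1^{\alpha_1}\cdots\partial\bar w_m^{\alpha_m}$ acts on the variable $\bar w$ of $K(\cdot,w)$. The characteristic space is $\mathbb V_w(\mathcal I)=\{q\in\mathbb C[\underline z]: q(D)p|_w=0\text{ for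 all }p\in\mathcal I\}$, and $\tilde{\mathbb V}_w(\mathcal I)=\{q\in\mathbb C[\underline z]:\partial q/\partial z_i\in\mathbb V_w(\mathcal I),\ 1\le i\le m\}$. *)

theory Defs
  imports "HOL-Analysis.Analysis" "HOL-Library.Poly_Mapping"
    "HOL-Library.Function_Algebras" "HOL-Library.Set_Algebras"
begin

section \<open>Polynomials in several variables\<close>

text \<open>
  A type \<open>'m\<close> of class \<open>{finite, linorder}\<close> plays the role of \<open>{1, \<dots>, m}\<close>. The order is only
  used to fix the order in which iterated partial derivatives are taken.
\<close>

type_synonym 'm mpol = "('m \<Rightarrow>\<^sub>0 nat) \<Rightarrow>\<^sub>0 complex"

definition mp_smult :: "complex \<Rightarrow> 'm mpol \<Rightarrow> 'm mpol" where
  "mp_smult c p = Poly_Mapping.map ((*) c) p"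

definition mp_eval :: "'m::finite mpol \<Rightarrow> complex^'m \<Rightarrow> complex" where
  "mp_eval p z =
    (\<Sum>\<alpha>\<in>Poly_Mapping.keys p. Poly_Mapping.lookup p \<alpha> * (\<Prod>i\<in>UNIV. (z $ i) ^ Poly_Mapping.lookup \<alpha> i))"

definition mp_ideal :: "'m mpol set \<Rightarrow> bool" where
  "mp_ideal I \<longleftrightarrow> 0 \<in> I \<and> (\<forall>p\<in>I. \<forall>q\<in>I. p + q \<in> I) \<and> (\<forall>r. \<forall>p\<in>I. r * p \<in> I)"

definition mp_maximal :: "complex^'m \<Rightarrow> 'm::finite mpol set" where
  "mp_maximal w = {p. mp_eval p w = 0}"

text \<open>The polynomial \<open>q\<^sup>*(z) = cnj (q (cnj z))\<close>, i.e. conjugation of the coefficients.\<close>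

definition mp_star :: "'m mpol \<Rightarrow> 'm mpol" where
  "mp_star q = Poly_Mapping.map cnj q"

text \<open>
  Formal partial derivative. The truncated subtraction in the exponent is harmless:
  if \<open>\<alpha>\<^sub>i = 0\<close> the coefficient vanishes.
\<close>

definition mp_diff :: "'m \<Rightarrow> 'm mpol \<Rightarrow> 'm mpol" where
  "mp_diff i p = (\<Sum>\<alpha>\<in>Poly_Mapping.keys p.
     Poly_Mapping.single (\<alpha> - Poly_Mapping.single i 1)
       (of_nat (Poly_Mapping.lookup \<alpha> i) * Poly_Mapping.lookup p \<alpha>))"

text \<open>
  \<open>multi_deriv d \<alpha>\<close> is \<open>d\<^sub>1 ^ \<alpha>\<^sub>1 \<circ> \<dots> \<circ> d\<^sub>m ^ \<alpha>\<^sub>m\<close> for a family \<open>d\<close> of first-order operators; it is used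
  both for \<open>\<partial>\<^sup>\<alpha>\<close> on polynomials and for the conjugate derivatives acting on the kernel.
\<close>

definition multi_deriv ::
    "('m::{finite,linorder} \<Rightarrow> 'a \<Rightarrow> 'a) \<Rightarrow> ('m \<Rightarrow>\<^sub>0 nat) \<Rightarrow> 'a \<Rightarrow> 'a" where
  "multi_deriv d \<alpha> =
    foldr (\<lambda>i F. (d i ^^ Poly_Mapping.lookup \<alpha> i) \<circ> F) (sorted_list_of_set UNIV) id"

text \<open>\<open>q(D) p\<close>\<close>

definition mp_diffop :: "'m::{finite,linorder} mpol \<Rightarrow> 'm mpol \<Rightarrow> 'm mpol" where
  "mp_diffop q p =
    (\<Sum>\<alpha>\<in>Poly_Mapping.keys q. mp_smult (Poly_Mapping.lookup q \<alpha>) (multi_deriv mp_diff \<alpha> p))"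

definition char_space ::
    "complex^('m::{finite,linorder}) \<Rightarrow> 'm mpol set \<Rightarrow> 'm mpol set" where
  "char_space w I = {q. \<forall>p\<in>I. mp_eval (mp_diffop q p) w = 0}"

definition char_space_tilde ::
    "complex^('m::{finite,linorder}) \<Rightarrow> 'm mpol set \<Rightarrow> 'm mpol set" where
  "char_space_tilde w I = {q. \<forall>i. mp_diff i q \<in> char_space w I}"


section \<open>Finite bases of subspaces and of quotient spaces\<close>

text \<open>
  Bases are families \<open>v 0, \<dots>, v (t - 1)\<close>, so repeated vectors are not linearly independent.
\<close>

definition lincomb ::
    "(complex \<Rightarrow> 'v \<Rightarrow> 'v) \<Rightarrow> nat \<Rightarrow> (nat \<Rightarrow> 'v) \<Rightarrow> (nat \<Rightarrow> complex) \<Rightarrow> 'v::comm_monoid_add" where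
  "lincomb smul t v c = (\<Sum>i<t. smul (c i) (v i))"

definition is_basis ::
    "(complex \<Rightarrow> 'v \<Rightarrow> 'v) \<Rightarrow> 'v::comm_monoid_add set \<Rightarrow> nat \<Rightarrow> (nat \<Rightarrow> 'v) \<Rightarrow> bool" where
  "is_basis smul U t v \<longleftrightarrow>
     (\<forall>i<t. v i \<in> U) \<and>
     (\<forall>c. lincomb smul t v c = 0 \<longrightarrow> (\<forall>i<t. c i = 0)) \<and>
     U = range (lincomb smul t v)"

text \<open>
  The elements of \<open>U / W\<close> are the cosets \<open>u +o W\<close> with \<open>u \<in> U\<close>; by definition of the vector space
  structure on \<open>U / W\<close>, the linear combination with coefficients \<open>c\<close> of the classes of the \<open>v i\<close> is the
  class of \<open>lincomb smul t v c\<close>. The zero vector is the class of \<open>0\<close>.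
\<close>

definition quotient_space :: "'v::comm_monoid_add set \<Rightarrow> 'v set \<Rightarrow> 'v set set" where
  "quotient_space U W = (\<lambda>u. u +o W) ` U"

definition is_quotient_basis ::
    "(complex \<Rightarrow> 'v \<Rightarrow> 'v) \<Rightarrow> 'v::comm_monoid_add set \<Rightarrow> 'v set \<Rightarrow> nat \<Rightarrow> (nat \<Rightarrow> 'v) \<Rightarrow> bool" where
  "is_quotient_basis smul U W t v \<longleftrightarrow>
     (\<forall>i<t. v i \<in> U) \<and>
     (\<forall>c. lincomb smul t v c +o W = 0 +o W \<longrightarrow> (\<forall>i<t. c i = 0)) \<and>
     quotient_space U W = range (\<lambda>c. lincomb smul t v c +o W)"


section \<open>Hilbert modules of holomorphic functions\<close>

definition bounded_domain :: "(complex^'m) set \<Rightarrow> bool" where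
  "bounded_domain \<Omega> \<longleftrightarrow> open \<Omega> \<and> connected \<Omega> \<and> bounded \<Omega> \<and> \<Omega> \<noteq> {}"

definition holomorphic_several :: "(complex^'m \<Rightarrow> complex) \<Rightarrow> (complex^'m) set \<Rightarrow> bool" where
  "holomorphic_several f \<Omega> \<longleftrightarrow>
     (\<forall>z\<in>\<Omega>. \<exists>f'. (f has_derivative f') (at z) \<and> (\<forall>c v. f' (c *s v) = c * f' v))"

definition fun_smult :: "complex \<Rightarrow> ('z \<Rightarrow> complex) \<Rightarrow> 'z \<Rightarrow> complex" where
  "fun_smult c f = (\<lambda>z. c * f z)"

definition hnorm :: "('v \<Rightarrow> 'v \<Rightarrow> complex) \<Rightarrow> 'v \<Rightarrow> real" where
  "hnorm ip f = sqrt (Re (ip f f))"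

text \<open>
  Functions on \<open>\<Omega>\<close> are represented by functions on the whole space that vanish off \<open>\<Omega>\<close>. Only the
  values of the inner product on \<open>H \<times> H\<close> matter; it is linear in the first argument.
\<close>

definition holomorphic_hilbert_space ::
    "(complex^'m) set \<Rightarrow> (complex^'m \<Rightarrow> complex) set \<Rightarrow>
     ((complex^'m \<Rightarrow> complex) \<Rightarrow> (complex^'m \<Rightarrow> complex) \<Rightarrow> complex) \<Rightarrow> bool" where
  "holomorphic_hilbert_space \<Omega> H ip \<longleftrightarrow>
     (\<forall>f\<in>H. holomorphic_several f \<Omega> \<and> (\<forall>z. z \<notin> \<Omega> \<longrightarrow> f z = 0)) \<and>
     0 \<in> H \<and> (\<forall>f\<in>H. \<forall>g\<in>H. f + g \<in> H) \<and> (\<forall>c. \<forall>f\<in>H. fun_smult c f \<in> H) \<and>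
     (\<forall>f\<in>H. \<forall>g\<in>H. \<forall>h\<in>H. ip (f + g) h = ip f h + ip g h) \<and>
     (\<forall>c. \<forall>f\<in>H. \<forall>g\<in>H. ip (fun_smult c f) g = c * ip f g) \<and>
     (\<forall>f\<in>H. \<forall>g\<in>H. ip g f = cnj (ip f g)) \<and>
     (\<forall>f\<in>H. f \<noteq> 0 \<longrightarrow> Re (ip f f) > 0) \<and>
     (\<forall>s. (\<forall>n. s n \<in> H) \<and>
          (\<forall>e>0. \<exists>N. \<forall>k\<ge>N. \<forall>n\<ge>N. hnorm ip (s k - s n) < e) \<longrightarrow>
          (\<exists>f\<in>H. (\<lambda>n. hnorm ip (s n - f)) \<longlonglongrightarrow> 0))"

definition mult_op :: "'m \<Rightarrow> (complex^'m \<Rightarrow> complex) \<Rightarrow> complex^'m \<Rightarrow> complex" where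
  "mult_op j f = (\<lambda>z. z $ j * f z)"

definition hilbert_module ::
    "(complex^'m) set \<Rightarrow> (complex^'m \<Rightarrow> complex) set \<Rightarrow>
     ((complex^'m \<Rightarrow> complex) \<Rightarrow> (complex^'m \<Rightarrow> complex) \<Rightarrow> complex) \<Rightarrow> bool" where
  "hilbert_module \<Omega> H ip \<longleftrightarrow>
     holomorphic_hilbert_space \<Omega> H ip \<and>
     (\<forall>j. (\<forall>f\<in>H. mult_op j f \<in> H) \<and> (\<exists>C. \<forall>f\<in>H. hnorm ip (mult_op j f) \<le> C * hnorm ip f))"

definition hadjoint ::
    "'v set \<Rightarrow> ('v \<Rightarrow> 'v \<Rightarrow> complex) \<Rightarrow> ('v \<Rightarrow> 'v) \<Rightarrow> 'v \<Rightarrow> 'v" where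
  "hadjoint H ip T g = (THE h. h \<in> H \<and> (\<forall>f\<in>H. ip (T f) g = ip f h))"

definition joint_kernel ::
    "(complex^'m \<Rightarrow> complex) set \<Rightarrow>
     ((complex^'m \<Rightarrow> complex) \<Rightarrow> (complex^'m \<Rightarrow> complex) \<Rightarrow> complex) \<Rightarrow>
     complex^'m \<Rightarrow> (complex^'m \<Rightarrow> complex) set" where
  "joint_kernel H ip w =
     (\<Inter>j. {g \<in> H. hadjoint H ip (\<lambda>f. mult_op j f - fun_smult (w $ j) f) g = 0})"

definition reproducing_kernel ::
    "(complex^'m) set \<Rightarrow> (complex^'m \<Rightarrow> complex) set \<Rightarrow>
     ((complex^'m \<Rightarrow> complex) \<Rightarrow> (complex^'m \<Rightarrow> complex) \<Rightarrow> complex) \<Rightarrow>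
     (complex^'m \<Rightarrow> complex^'m \<Rightarrow> complex) \<Rightarrow> bool" where
  "reproducing_kernel \<Omega> H ip K \<longleftrightarrow>
     (\<forall>w\<in>\<Omega>. (\<lambda>z. K z w) \<in> H \<and> (\<forall>f\<in>H. ip f (\<lambda>z. K z w) = f w))"

text \<open>
  \<open>\<mm>\<^sub>w H\<close> is the algebraic product, consisting of finite sums of products; no closure is taken.
\<close>

definition maximal_submodule ::
    "complex^'m \<Rightarrow> (complex^'m \<Rightarrow> complex) set \<Rightarrow> (complex^'m::finite \<Rightarrow> complex) set" where
  "maximal_submodule w H =
     {\<Sum>i<n. mp_eval (p i) * f i | n p f. \<forall>i<(n::nat). p i \<in> mp_maximal w \<and> f i \<in> H}"

text \<open>
  Nothing is required of the diagonal of the reproducing kernel: \<open>K w w = 0\<close> is allowed.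
\<close>

definition class_B1 ::
    "(complex^'m) set \<Rightarrow> (complex^'m \<Rightarrow> complex) set \<Rightarrow>
     ((complex^'m \<Rightarrow> complex) \<Rightarrow> (complex^'m \<Rightarrow> complex) \<Rightarrow> complex) \<Rightarrow> bool" where
  "class_B1 \<Omega> H ip \<longleftrightarrow>
     hilbert_module \<Omega> H ip \<and>
     (\<exists>K. reproducing_kernel \<Omega> H ip K) \<and>
     (\<forall>w\<in>\<Omega>. \<exists>n b. is_quotient_basis fun_smult H (maximal_submodule w H) n b)"

definition mp_fun :: "(complex^'m) set \<Rightarrow> 'm::finite mpol \<Rightarrow> complex^'m \<Rightarrow> complex" where
  "mp_fun \<Omega> p = (\<lambda>z. if z \<in> \<Omega> then mp_eval p z else 0)"

definition completion_of_ideal ::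
    "(complex^'m) set \<Rightarrow> 'm::finite mpol set \<Rightarrow> (complex^'m \<Rightarrow> complex) set \<Rightarrow>
     ((complex^'m \<Rightarrow> complex) \<Rightarrow> (complex^'m \<Rightarrow> complex) \<Rightarrow> complex) \<Rightarrow> bool" where
  "completion_of_ideal \<Omega> I H ip \<longleftrightarrow>
     mp_fun \<Omega> ` I \<subseteq> H \<and>
     (\<forall>f\<in>H. \<forall>e>0. \<exists>p\<in>I. hnorm ip (f - mp_fun \<Omega> p) < e)"


section \<open>Conjugate derivatives of the kernel\<close>

text \<open>
  The Wirtinger derivative with respect to the conjugate of the \<open>i\<close>-th coordinate,
  \<open>(\<partial>/\<partial>x\<^sub>i + \<i> \<partial>/\<partial>y\<^sub>i) / 2\<close>.
\<close>

definition dbar :: "'m::finite \<Rightarrow> (complex^'m \<Rightarrow> complex) \<Rightarrow> complex^'m \<Rightarrow> complex" where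
  "dbar i F w =
     (vector_derivative (\<lambda>s::real. F (w + axis i (of_real s))) (at 0) +
      \<i> * vector_derivative (\<lambda>s::real. F (w + axis i (\<i> * of_real s))) (at 0)) / 2"

definition dbar_op ::
    "'m mpol \<Rightarrow> (complex^('m::{finite,linorder}) \<Rightarrow> complex) \<Rightarrow> complex^('m::{finite,linorder}) \<Rightarrow> complex" where
  "dbar_op q F w = (\<Sum>\<alpha>\<in>Poly_Mapping.keys q. Poly_Mapping.lookup q \<alpha> * multi_deriv dbar \<alpha> F w)"

text \<open>The function \<open>z \<mapsto> q(D\<^sup>-) K(z, w)\<close>, where \<open>D\<^sup>-\<close> acts on the second argument of \<open>K\<close>.\<close>

definition kernel_deriv ::
    "'m mpol \<Rightarrow> (complex^('m::{finite,linorder}) \<Rightarrow> complex^('m::{finite,linorder}) \<Rightarrow> complex) \<Rightarrow>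
     complex^('m::{finite,linorder}) \<Rightarrow> complex^('m::{finite,linorder}) \<Rightarrow> complex" where
  "kernel_deriv q K w = (\<lambda>z. dbar_op q (K z) w)"

end

theory Submission
  imports Defs "HOL-Complex_Analysis.Cauchy_Integral_Formula"
begin

text \<open>
  Write \<open>\<langle>q, p\<rangle> = (q(D) p)(w\<^sub>0)\<close>. Everything rests on the map
  \<open>G q = q\<^sup>*(D\<^sup>-) K(\<cdot>, w)\<close> at \<open>w = w\<^sub>0\<close>, which is conjugate-linear in \<open>q\<close>, and on the identity
  \<open>ip p (G q) = \<langle>q, p\<rangle>\<close> for polynomials \<open>p\<close> in \<open>I\<close>: the kernel derivative represents the
  functional \<open>f \<mapsto> (q(D) f)(w\<^sub>0)\<close> on the Hilbert space. As \<open>I\<close> is dense, a vector of the space is determined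
  by its inner products with \<open>I\<close>, so each question about \<open>G q\<close> becomes one about \<open>\<langle>q, \<cdot>\<rangle>\<close> on \<open>I\<close>.

  \<^item> \<open>G q = 0\<close> iff \<open>q\<close> lies in the characteristic space, by definition of that space.

  \<^item> \<open>G q\<close> lies in the joint kernel iff \<open>\<langle>q, (z\<^sub>j - w\<^sub>0\<^sub>j) p\<rangle> = 0\<close> for all \<open>j\<close> and \<open>p \<in> I\<close>. By the
  Leibniz rule this number is \<open>\<langle>\<partial>q/\<partial>z\<^sub>j, p\<rangle>\<close> (\<open>diff_pairing_shifted_var_mult\<close>), so the condition
  says that \<open>q\<close> lies in the enlarged characteristic space.

  \<^item> Each \<open>g\<close> in the joint kernel is some \<open>G q\<close>. The functional \<open>\<phi> p = ip p g\<close> on \<open>I\<close> kills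
  \<open>\<mm> I\<close>, where \<open>\<mm>\<close> is the maximal ideal at \<open>w\<^sub>0\<close>. By a form of the Artin-Rees lemma there is an ideal
  \<open>J\<close> with \<open>J \<inter> I = \<mm> I\<close> that contains a power of each \<open>z\<^sub>j - w\<^sub>0\<^sub>j\<close>
  (\<open>exists_ideal_containing_powers\<close>). Hence \<open>\<phi>\<close> extends to a linear functional on all polynomials
  that kills \<open>J\<close>; it sees only finitely many Taylor coefficients at \<open>w\<^sub>0\<close> and so has the form
  \<open>\<langle>q, \<cdot>\<rangle>\<close> (\<open>ideal_functional_eq_diff_pairing\<close>).

  Consequently \<open>G\<close> induces a conjugate-linear bijection from the quotient of the two characteristic spaces onto the
  joint kernel, and such a map carries bases to bases (\<open>basis_iff_quotient_basis\<close>).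

  The identity \<open>ip f (G q) = (q(D) f)(w\<^sub>0)\<close> needs that \<open>f \<mapsto> (\<partial>\<^sup>\<alpha> f)(w)\<close> is represented by a
  vector of the space. This is an induction on the number of derivatives: a derivative is the limit of difference
  quotients, which are represented by the induction hypothesis, and a pointwise limit of representable functionals is
  representable by the uniform boundedness principle and the Riesz representation theorem
  (\<open>weak_limit_representable\<close>, \<open>derivative_representable\<close>).
\<close>


section \<open>Formal differentiation of polynomials\<close>

text \<open>
  The exponent of the \<open>i\<close>-th variable is written \<open>single i 1\<close>; simplification must not turn the
  coordinate value into \<open>Suc 0\<close>, or the rules about it no longer apply.
\<close>

declare One_nat_def [simp del]

text \<open>
  The linear functional with value \<open>F \<alpha>\<close> on the monomial with exponent \<open>\<alpha>\<close>. Evaluation of a polynomial,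
  \<open>q \<mapsto> (q(D) p)(w)\<close> and \<open>q \<mapsto> (q(D) f)(w)\<close> are all of this form, which settles their linearity once
  and for all.
\<close>

definition mp_lin :: "('k \<Rightarrow> complex) \<Rightarrow> ('k \<Rightarrow>\<^sub>0 complex) \<Rightarrow> complex" where
  "mp_lin F p = (\<Sum>\<alpha>\<in>Poly_Mapping.keys p. Poly_Mapping.lookup p \<alpha> * F \<alpha>)"

lemma mp_lin_superset:
  assumes "finite S" "Poly_Mapping.keys p \<subseteq> S"
  shows "mp_lin F p = (\<Sum>\<alpha>\<in>S. Poly_Mapping.lookup p \<alpha> * F \<alpha>)"
  unfolding mp_lin_def
  by (rule sum.mono_neutral_left) (use assms in \<open>auto simp: in_keys_iff\<close>)

lemma mp_lin_zero [simp]: "mp_lin F 0 = 0"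
  by (simp add: mp_lin_def)

lemma mp_lin_add: "mp_lin F (p + q) = mp_lin F p + mp_lin F q"
proof -
  let ?S = "Poly_Mapping.keys p \<union> Poly_Mapping.keys q"
  have "mp_lin F (p + q) = (\<Sum>\<alpha>\<in>?S. Poly_Mapping.lookup (p + q) \<alpha> * F \<alpha>)"
    by (rule mp_lin_superset) (use keys_add[of p q] in auto)
  also have "\<dots> = mp_lin F p + mp_lin F q"
    by (simp add: mp_lin_superset[of ?S p] mp_lin_superset[of ?S q] lookup_add
        distrib_right sum.distrib)
  finally show ?thesis .
qed

lemma lookup_mp_smult [simp]: "Poly_Mapping.lookup (mp_smult c p) \<alpha> = c * Poly_Mapping.lookup p \<alpha>"
  by (auto simp: mp_smult_def map.rep_eq when_def)

lemma mp_smult_conv_mult: "mp_smult c p = Poly_Mapping.single 0 c * p"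
  by (simp add: mp_smult_def mult_map_scale_conv_mult)

lemma mp_smult_single [simp]: "mp_smult c (Poly_Mapping.single \<alpha> d) = Poly_Mapping.single \<alpha> (c * d)"
  by (simp add: mp_smult_conv_mult mult_single)

interpretation mpol: vector_space mp_smult
  by unfold_locales (auto simp: lookup_add algebra_simps intro!: poly_mapping_eqI)

lemma mp_lin_smult: "mp_lin F (mp_smult c p) = c * mp_lin F p"
proof -
  have "mp_lin F (mp_smult c p) =
      (\<Sum>\<alpha>\<in>Poly_Mapping.keys p. Poly_Mapping.lookup (mp_smult c p) \<alpha> * F \<alpha>)"
    by (rule mp_lin_superset) (auto simp: in_keys_iff)
  then show ?thesis
    by (simp add: mp_lin_def sum_distrib_left mult.assoc)
qed

lemma mp_lin_single [simp]: "mp_lin F (Poly_Mapping.single \<alpha> c) = c * F \<alpha>"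
  by (cases "c = 0") (auto simp: mp_lin_def)

lemma mp_lin_sum: "mp_lin F (sum p A) = (\<Sum>a\<in>A. mp_lin F (p a))"
  by (induction A rule: infinite_finite_induct) (auto simp: mp_lin_add)

lemma mpol_induct [case_names single add]:
  assumes single: "\<And>\<alpha> c. P (Poly_Mapping.single \<alpha> c)"
    and add: "\<And>p q. P p \<Longrightarrow> P q \<Longrightarrow> P (p + q)"
  shows "P (p :: 'k \<Rightarrow>\<^sub>0 complex)"
proof (induction p rule: update_induct)
  case const
  show ?case using single[of undefined 0] by simp
next
  case (update f a b)
  have "Poly_Mapping.update a b f = f + Poly_Mapping.single a b"
    by (rule poly_mapping_eqI)
       (use update in \<open>auto simp: lookup_update lookup_add lookup_single when_def in_keys_iff\<close>)
  then show ?case using add[OF update(3) single] by simp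
qed

lemma exponent_split:
  fixes \<alpha> :: "'m \<Rightarrow>\<^sub>0 nat"
  assumes "Poly_Mapping.lookup \<alpha> i \<noteq> 0"
  shows "Poly_Mapping.single i 1 + (\<alpha> - Poly_Mapping.single i 1) = \<alpha>"
  by (rule poly_mapping_eqI) (use assms in \<open>auto simp: lookup_add lookup_minus lookup_single when_def\<close>)

text \<open>
  Exponents are reached from \<open>0\<close> by raising one coordinate at a time, in any order.
\<close>

lemma exponent_induct [case_names zero step]:
  fixes \<alpha> :: "'m::finite \<Rightarrow>\<^sub>0 nat"
  assumes zero: "P 0" and step: "\<And>i \<alpha>. P \<alpha> \<Longrightarrow> P (Poly_Mapping.single i 1 + \<alpha>)"
  shows "P \<alpha>"
proof (induction "\<Sum>i\<in>UNIV. Poly_Mapping.lookup \<alpha> i" arbitrary: \<alpha>)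
  case 0
  then have "\<alpha> = 0" by (intro poly_mapping_eqI) auto
  then show ?case using zero by simp
next
  case (Suc n)
  then obtain i where i: "Poly_Mapping.lookup \<alpha> i \<noteq> 0"
    by (metis sum.neutral nat.distinct(1))
  let ?\<beta> = "\<alpha> - Poly_Mapping.single i 1"
  have "Suc n = (\<Sum>j\<in>UNIV. Poly_Mapping.lookup (Poly_Mapping.single i 1 + ?\<beta>) j)"
    using Suc(2) exponent_split[OF i] by simp
  also have "\<dots> = 1 + (\<Sum>j\<in>UNIV. Poly_Mapping.lookup ?\<beta> j)"
    by (simp add: lookup_add sum.distrib lookup_single when_def)
  finally have "P ?\<beta>" using Suc(1) by simp
  from step[OF this, of i] show ?case using exponent_split[OF i] by simp
qed

definition mono_eval :: "complex^'m \<Rightarrow> ('m::finite \<Rightarrow>\<^sub>0 nat) \<Rightarrow> complex" where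
  "mono_eval z \<alpha> = (\<Prod>i\<in>UNIV. (z $ i) ^ Poly_Mapping.lookup \<alpha> i)"

lemma mp_eval_eq_lin: "mp_eval p z = mp_lin (mono_eval z) p"
  by (simp add: mp_eval_def mp_lin_def mono_eval_def)

lemma mono_eval_add: "mono_eval z (\<alpha> + \<beta>) = mono_eval z \<alpha> * mono_eval z \<beta>"
  by (simp add: mono_eval_def lookup_add power_add prod.distrib)

lemma mono_eval_zero [simp]: "mono_eval z 0 = 1"
  by (simp add: mono_eval_def)

lemma mono_eval_single [simp]: "mono_eval z (Poly_Mapping.single i n) = (z $ i) ^ n"
proof -
  have "(\<Prod>j\<in>UNIV. (z $ j) ^ Poly_Mapping.lookup (Poly_Mapping.single i n) j) =
        (\<Prod>j\<in>UNIV. if j = i then (z $ i) ^ n else 1)"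
    by (intro prod.cong) (auto simp: lookup_single when_def)
  then show ?thesis by (simp add: mono_eval_def)
qed

lemma mp_eval_add: "mp_eval (p + q) z = mp_eval p z + mp_eval q z"
  by (simp add: mp_eval_eq_lin mp_lin_add)

lemma mp_eval_smult: "mp_eval (mp_smult c p) z = c * mp_eval p z"
  by (simp add: mp_eval_eq_lin mp_lin_smult)

lemma mp_eval_sum: "mp_eval (sum p A) z = (\<Sum>a\<in>A. mp_eval (p a) z)"
  by (simp add: mp_eval_eq_lin mp_lin_sum)

lemma mp_eval_zero [simp]: "mp_eval 0 z = 0"
  by (simp add: mp_eval_eq_lin)

lemma mp_eval_single: "mp_eval (Poly_Mapping.single \<alpha> c) z = c * mono_eval z \<alpha>"
  by (simp add: mp_eval_eq_lin)

lemma mp_eval_one [simp]: "mp_eval 1 z = 1"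
  using mp_eval_single[of 0 1 z] by simp

lemma mp_eval_mult: "mp_eval (p * q) z = mp_eval p z * mp_eval q z"
proof (induction p rule: mpol_induct)
  case (single \<alpha> c)
  show ?case
    by (induction q rule: mpol_induct)
       (auto simp: mult_single mp_eval_single mono_eval_add mp_eval_add algebra_simps)
qed (simp add: mp_eval_add algebra_simps)

definition shifted_var :: "complex^'m \<Rightarrow> 'm::finite \<Rightarrow> 'm mpol" where
  "shifted_var w i = Poly_Mapping.single (Poly_Mapping.single i 1) 1 - Poly_Mapping.single 0 (w $ i)"

lemma shifted_var_mult:
  "shifted_var w i * p = Poly_Mapping.single (Poly_Mapping.single i 1) 1 * p + mp_smult (- (w $ i)) p"
  by (simp add: shifted_var_def mp_smult_conv_mult left_diff_distrib single_uminus)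

lemma mp_eval_shifted_var [simp]: "mp_eval (shifted_var w i) z = z $ i - w $ i"
proof -
  have "shifted_var w i = Poly_Mapping.single (Poly_Mapping.single i 1) 1 + Poly_Mapping.single 0 (- w $ i)"
    by (simp add: shifted_var_def single_uminus)
  then show ?thesis by (simp add: mp_eval_add mp_eval_single del: single_uminus)
qed

lemma lookup_mp_diff:
  "Poly_Mapping.lookup (mp_diff i p) \<gamma> =
    mp_lin (\<lambda>\<alpha>. if \<alpha> - Poly_Mapping.single i 1 = \<gamma> then of_nat (Poly_Mapping.lookup \<alpha> i) else 0) p"
  by (auto simp: mp_diff_def mp_lin_def lookup_sum lookup_single when_def intro!: sum.cong)

lemma mp_diff_add: "mp_diff i (p + q) = mp_diff i p + mp_diff i q"
  by (rule poly_mapping_eqI) (simp add: lookup_mp_diff lookup_add mp_lin_add)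

lemma mp_diff_smult: "mp_diff i (mp_smult c p) = mp_smult c (mp_diff i p)"
  by (rule poly_mapping_eqI) (simp add: lookup_mp_diff mp_lin_smult)

lemma mp_diff_single:
  "mp_diff i (Poly_Mapping.single \<alpha> c) =
    Poly_Mapping.single (\<alpha> - Poly_Mapping.single i 1) (of_nat (Poly_Mapping.lookup \<alpha> i) * c)"
  by (rule poly_mapping_eqI) (auto simp: lookup_mp_diff lookup_single when_def)

lemma mp_diff_zero [simp]: "mp_diff i 0 = 0"
  by (rule poly_mapping_eqI) (simp add: lookup_mp_diff)

lemma mp_diff_one [simp]: "mp_diff i 1 = 0"
  using mp_diff_single[of i 0 1] by simp

lemma mp_lin_diff:
  "mp_lin F (mp_diff i q) =
    mp_lin (\<lambda>\<alpha>. of_nat (Poly_Mapping.lookup \<alpha> i) * F (\<alpha> - Poly_Mapping.single i 1)) q"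
  by (induction q rule: mpol_induct) (auto simp: mp_diff_single mp_diff_add mp_lin_add)

lemma mp_diff_var_mult:
  "mp_diff i (Poly_Mapping.single (Poly_Mapping.single j 1) 1 * p) =
    Poly_Mapping.single (Poly_Mapping.single j 1) 1 * mp_diff i p + (if i = j then p else 0)"
proof (induction p rule: mpol_induct)
  case (single \<alpha> c)
  show ?case
  proof (cases "Poly_Mapping.lookup \<alpha> i = 0")
    case True
    then show ?thesis
      by (auto simp: mult_single mp_diff_single lookup_add lookup_single when_def)
  next
    case False
    have *: "Poly_Mapping.single j 1 + \<alpha> - Poly_Mapping.single i 1 =
        Poly_Mapping.single j 1 + (\<alpha> - Poly_Mapping.single i 1)"
      by (rule poly_mapping_eqI)
         (use False in \<open>auto simp: lookup_add lookup_minus lookup_single when_def\<close>)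
    show ?thesis
      using exponent_split[OF False]
      by (auto simp: mult_single mp_diff_single lookup_add lookup_single * distrib_right add.commute[of c]
          single_add[symmetric] when_def)
  qed
qed (auto simp: mp_diff_add algebra_simps)

lemma mp_diff_shifted_var_mult:
  "mp_diff i (shifted_var w j * p) = shifted_var w j * mp_diff i p + (if i = j then p else 0)"
  unfolding shifted_var_mult mp_diff_add mp_diff_smult mp_diff_var_mult by simp

lemma mp_diff_funpow_shifted_var_mult:
  "(mp_diff i ^^ k) (shifted_var w j * p) = shifted_var w j * (mp_diff i ^^ k) p +
    (if i = j then mp_smult (of_nat k) ((mp_diff i ^^ (k - 1)) p) else 0)"
proof (induction k)
  case (Suc k)
  show ?case
  proof (cases "i = j")
    case True
    have "mp_smult (of_nat k) (mp_diff i ((mp_diff i ^^ (k - 1)) p)) =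
        mp_smult (of_nat k) ((mp_diff i ^^ k) p)"
      by (cases k) auto
    then show ?thesis
      using Suc True
      by (simp add: mp_diff_add mp_diff_smult mp_diff_shifted_var_mult mpol.scale_left_distrib)
  qed (use Suc in \<open>simp add: mp_diff_shifted_var_mult mp_diff_add\<close>)
qed simp

text \<open>
  Only the first-order operators enter the definition of \<^const>\<open>multi_deriv\<close>, so a relation between two families
  of operators need only be checked for one composition step. This avoids all reasoning about the order in which the
  derivatives are taken.
\<close>

lemma multi_deriv_rel:
  assumes "R id id" and step: "\<And>i F G. R F G \<Longrightarrow> R (d i \<circ> F) (e i \<circ> G)"
  shows "R (multi_deriv d \<alpha>) (multi_deriv e \<alpha>)"
proof -
  have pow: "R ((d i ^^ n) \<circ> F) ((e i ^^ n) \<circ> G)" if "R F G" for i n F G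
  proof (induction n)
    case (Suc n)
    show ?case using step[OF Suc, of i] by (simp add: comp_def)
  qed (use that in simp)
  have "R (foldr (\<lambda>i F. (d i ^^ Poly_Mapping.lookup \<alpha> i) \<circ> F) xs id)
          (foldr (\<lambda>i F. (e i ^^ Poly_Mapping.lookup \<alpha> i) \<circ> F) xs id)" for xs
  proof (induction xs)
    case (Cons i xs)
    show ?case using pow[OF Cons, where i = i and n = "Poly_Mapping.lookup \<alpha> i"] by (simp add: comp_def)
  qed (use assms(1) in \<open>simp add: id_def\<close>)
  then show ?thesis unfolding multi_deriv_def .
qed

lemma multi_deriv_ind:
  assumes "P id" and "\<And>i F. P F \<Longrightarrow> P (d i \<circ> F)"
  shows "P (multi_deriv d \<alpha>)"
  using multi_deriv_rel[of "\<lambda>F _. P F" d d \<alpha>] assms by blast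

text \<open>
  The Leibniz rule for \<open>\<partial>\<^sup>\<alpha>\<close> and a linear factor: all second derivatives of the factor vanish, which leaves
  two terms. Since each variable occurs once in the list of derivatives, the induction over that list needs no
  commutation of partial derivatives.
\<close>

lemma multi_deriv_mp_diff_shifted_var_mult:
  fixes w :: "complex^('m::{finite,linorder})"
  shows "multi_deriv mp_diff \<alpha> (shifted_var w j * p) =
    shifted_var w j * multi_deriv mp_diff \<alpha> p +
    mp_smult (of_nat (Poly_Mapping.lookup \<alpha> j)) (multi_deriv mp_diff (\<alpha> - Poly_Mapping.single j 1) p)"
proof -
  define F where "F \<alpha> xs = foldr (\<lambda>i F. (mp_diff i ^^ Poly_Mapping.lookup \<alpha> i) \<circ> F) xs id"
    for \<alpha> and xs :: "'m list"
  let ?\<alpha>' = "\<alpha> - Poly_Mapping.single j 1"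
  have pow_add: "(mp_diff i ^^ k) (p + q) = (mp_diff i ^^ k) p + (mp_diff i ^^ k) q"
    for i :: 'm and k p q by (induction k) (auto simp: mp_diff_add)
  have pow_smult: "(mp_diff i ^^ k) (mp_smult c p) = mp_smult c ((mp_diff i ^^ k) p)"
    for i :: 'm and k c p by (induction k) (auto simp: mp_diff_smult)
  have pow_zero: "(mp_diff i ^^ k) 0 = 0" for i :: 'm and k
    by (induction k) auto
  have notin: "F ?\<alpha>' xs = F \<alpha> xs" if "j \<notin> set xs" for xs
    using that unfolding F_def
    by (induction xs) (auto simp: lookup_minus lookup_single when_def)
  have "F \<alpha> xs (shifted_var w j * p) = shifted_var w j * F \<alpha> xs p +
      (if j \<in> set xs then mp_smult (of_nat (Poly_Mapping.lookup \<alpha> j)) (F ?\<alpha>' xs p) else 0)"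
    if "distinct xs" for xs
    using that
  proof (induction xs)
    case (Cons i xs)
    have F_Cons: "F \<beta> (i # xs) = (mp_diff i ^^ Poly_Mapping.lookup \<beta> i) \<circ> F \<beta> xs" for \<beta> i xs
      by (simp add: F_def)
    show ?case
    proof (cases "i = j")
      case True
      then show ?thesis using Cons notin[of xs]
        by (simp add: F_Cons mp_diff_funpow_shifted_var_mult lookup_minus lookup_single)
    next
      case False
      then show ?thesis using Cons
        by (auto simp: F_Cons mp_diff_funpow_shifted_var_mult pow_add pow_smult pow_zero
            lookup_minus lookup_single)
    qed
  qed (simp add: F_def)
  from this[of "sorted_list_of_set UNIV"] show ?thesis
    by (simp add: multi_deriv_def F_def)
qed

lemma multi_deriv_mp_diff_one:
  "multi_deriv mp_diff (\<alpha> :: 'm::{finite,linorder} \<Rightarrow>\<^sub>0 nat) 1 = (if \<alpha> = 0 then 1 else 0)"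
proof -
  have pow0: "(mp_diff i ^^ k) 0 = 0" for i :: 'm and k
    by (induction k) auto
  have pow1: "(mp_diff i ^^ k) 1 = (if k = 0 then 1 else 0)" for i :: 'm and k
    by (induction k) auto
  have "foldr (\<lambda>i F. (mp_diff i ^^ Poly_Mapping.lookup \<alpha> i) \<circ> F) xs id 1 =
      (if \<forall>i\<in>set xs. Poly_Mapping.lookup \<alpha> i = 0 then 1 else 0)" for xs
    by (induction xs) (auto simp: pow0 pow1)
  moreover have "\<alpha> = 0 \<longleftrightarrow> (\<forall>i. Poly_Mapping.lookup \<alpha> i = 0)"
    by (auto intro: poly_mapping_eqI)
  ultimately show ?thesis by (simp add: multi_deriv_def)
qed

lemma multi_deriv_mp_diff_add:
  "multi_deriv mp_diff \<alpha> (p + q) = multi_deriv mp_diff \<alpha> p + multi_deriv mp_diff \<alpha> q"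
  by (rule multi_deriv_ind[of "\<lambda>F. F (p + q) = F p + F q"]) (auto simp: mp_diff_add)

lemma multi_deriv_mp_diff_smult:
  "multi_deriv mp_diff \<alpha> (mp_smult c p) = mp_smult c (multi_deriv mp_diff \<alpha> p)"
  by (rule multi_deriv_ind[of "\<lambda>F. F (mp_smult c p) = mp_smult c (F p)"]) (auto simp: mp_diff_smult)

definition diff_pairing :: "complex^('m::{finite,linorder}) \<Rightarrow> 'm mpol \<Rightarrow> 'm mpol \<Rightarrow> complex" where
  "diff_pairing w q p = mp_eval (mp_diffop q p) w"

lemma diff_pairing_eq_lin:
  "diff_pairing w q p = mp_lin (\<lambda>\<alpha>. mp_eval (multi_deriv mp_diff \<alpha> p) w) q"
  by (simp add: diff_pairing_def mp_diffop_def mp_eval_sum mp_eval_smult mp_lin_def)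

lemma char_space_eq: "char_space w I = {q. \<forall>p\<in>I. diff_pairing w q p = 0}"
  by (simp add: char_space_def diff_pairing_def)

lemma diff_pairing_zero_left: "diff_pairing w 0 p = 0"
  by (simp add: diff_pairing_eq_lin)

lemma diff_pairing_add_left: "diff_pairing w (q + q') p = diff_pairing w q p + diff_pairing w q' p"
  by (simp add: diff_pairing_eq_lin mp_lin_add)

lemma diff_pairing_smult_left: "diff_pairing w (mp_smult c q) p = c * diff_pairing w q p"
  by (simp add: diff_pairing_eq_lin mp_lin_smult)

lemma diff_pairing_add_right: "diff_pairing w q (p + p') = diff_pairing w q p + diff_pairing w q p'"
  by (simp add: diff_pairing_eq_lin multi_deriv_mp_diff_add mp_eval_add mp_lin_def
      distrib_left sum.distrib)

lemma diff_pairing_smult_right: "diff_pairing w q (mp_smult c p) = c * diff_pairing w q p"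
  by (simp add: diff_pairing_eq_lin multi_deriv_mp_diff_smult mp_eval_smult mp_lin_def
      sum_distrib_left mult.left_commute)

text \<open>
  Multiplication by \<open>z\<^sub>j - w\<^sub>j\<close> and \<open>\<partial>/\<partial>z\<^sub>j\<close> are adjoint for the pairing at \<open>w\<close>: in the Leibniz rule the
  term that keeps the factor \<open>z\<^sub>j - w\<^sub>j\<close> vanishes at \<open>w\<close>. This is what ties the enlarged characteristic space to
  the joint kernel.
\<close>

lemma diff_pairing_shifted_var_mult:
  "diff_pairing w q (shifted_var w j * p) = diff_pairing w (mp_diff j q) p"
  by (simp add: diff_pairing_eq_lin mp_lin_diff multi_deriv_mp_diff_shifted_var_mult
      mp_eval_add mp_eval_mult mp_eval_smult)

lemma diff_pairing_linear: "Vector_Spaces.linear mp_smult (*) (diff_pairing w q)"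
  by unfold_locales (auto simp: diff_pairing_add_right diff_pairing_smult_right algebra_simps)

definition shifted_monomial :: "complex^'m \<Rightarrow> ('m::finite \<Rightarrow>\<^sub>0 nat) \<Rightarrow> 'm mpol" where
  "shifted_monomial w \<beta> = (\<Prod>i\<in>UNIV. shifted_var w i ^ Poly_Mapping.lookup \<beta> i)"

lemma shifted_monomial_zero [simp]: "shifted_monomial w 0 = 1"
  by (simp add: shifted_monomial_def)

lemma shifted_monomial_step:
  "shifted_monomial w (Poly_Mapping.single i 1 + \<beta>) = shifted_var w i * shifted_monomial w \<beta>"
proof -
  have "(\<Prod>j\<in>UNIV. shifted_var w j ^ Poly_Mapping.lookup (Poly_Mapping.single i 1) j) =
        (\<Prod>j\<in>UNIV. if j = i then shifted_var w i else 1)"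
    by (intro prod.cong) (auto simp: lookup_single when_def)
  then show ?thesis
    by (simp add: shifted_monomial_def lookup_add power_add prod.distrib)
qed

text \<open>
  The powers of \<open>z - w\<close> are biorthogonal to the derivatives at \<open>w\<close>; the constant is \<open>\<beta>!\<close>, of which only
  \<open>\<beta>! \<noteq> 0\<close> matters below.
\<close>

lemma deriv_shifted_monomial_at_center:
  "\<exists>c. c \<noteq> 0 \<and> (\<forall>\<alpha>. mp_eval (multi_deriv mp_diff \<alpha> (shifted_monomial w \<beta>)) w = (if \<alpha> = \<beta> then c else 0))"
proof (induction \<beta> rule: exponent_induct)
  case zero
  show ?case
    by (intro exI[of _ 1]) (auto simp: multi_deriv_mp_diff_one)
next
  case (step i \<beta>)
  then obtain c where c: "c \<noteq> 0"
    "\<And>\<alpha>. mp_eval (multi_deriv mp_diff \<alpha> (shifted_monomial w \<beta>)) w = (if \<alpha> = \<beta> then c else 0)"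
    by blast
  let ?e = "Poly_Mapping.single i (1::nat)"
  have eq: "mp_eval (multi_deriv mp_diff \<alpha> (shifted_monomial w (?e + \<beta>))) w =
      of_nat (Poly_Mapping.lookup \<alpha> i) * (if \<alpha> - ?e = \<beta> then c else 0)" for \<alpha>
    by (simp only: shifted_monomial_step multi_deriv_mp_diff_shifted_var_mult mp_eval_add
        mp_eval_mult mp_eval_smult c(2) mp_eval_shifted_var) simp
  have iff: "Poly_Mapping.lookup \<alpha> i \<noteq> 0 \<and> \<alpha> - ?e = \<beta> \<longleftrightarrow> \<alpha> = ?e + \<beta>" for \<alpha>
    using exponent_split[of \<alpha> i] by (auto simp: lookup_add)
  show ?case
  proof (intro exI[of _ "of_nat (Suc (Poly_Mapping.lookup \<beta> i)) * c"] conjI allI)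
    fix \<alpha>
    show "mp_eval (multi_deriv mp_diff \<alpha> (shifted_monomial w (?e + \<beta>))) w =
        (if \<alpha> = ?e + \<beta> then of_nat (Suc (Poly_Mapping.lookup \<beta> i)) * c else 0)"
      unfolding eq using iff[of \<alpha>] by (auto simp: lookup_add)
  qed (use c(1) in \<open>simp del: of_nat_Suc\<close>)
qed

text \<open>
  The existence part of the Taylor expansion at \<open>w\<close>. The span is closed under multiplication by \<open>z\<^sub>i - w\<^sub>i\<close>, hence by \<open>z\<^sub>i\<close>, and contains \<open>1\<close>.
\<close>

lemma span_shifted_monomials: "mpol.span (range (shifted_monomial w)) = UNIV"
proof -
  let ?S = "mpol.span (range (shifted_monomial w))"
  have shift: "shifted_var w i * p \<in> ?S" if "p \<in> ?S" for p i
    using that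
  proof (induction rule: mpol.span_induct_alt)
    case (step c x y)
    then obtain \<beta> where "x = shifted_monomial w \<beta>" by blast
    then have "shifted_var w i * x \<in> ?S"
      by (metis mpol.span_base rangeI shifted_monomial_step)
    then have "mp_smult c (shifted_var w i * x) + shifted_var w i * y \<in> ?S"
      using step by (intro mpol.span_add mpol.span_scale)
    moreover have "shifted_var w i * (mp_smult c x + y) =
        mp_smult c (shifted_var w i * x) + shifted_var w i * y"
      by (simp add: mp_smult_conv_mult algebra_simps)
    ultimately show ?case by simp
  qed (simp add: mpol.span_zero)
  have var: "Poly_Mapping.single (Poly_Mapping.single i 1) 1 * p \<in> ?S" if "p \<in> ?S" for p i
  proof -
    have "Poly_Mapping.single (Poly_Mapping.single i 1) 1 * p =
        shifted_var w i * p + mp_smult (w $ i) p"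
      by (simp add: shifted_var_def mp_smult_conv_mult left_diff_distrib)
    then show ?thesis using shift[OF that] that by (auto intro: mpol.span_add mpol.span_scale)
  qed
  have one: "Poly_Mapping.single \<alpha> 1 \<in> ?S" for \<alpha>
  proof (induction \<alpha> rule: exponent_induct)
    case zero
    have "shifted_monomial w 0 \<in> ?S" by (intro mpol.span_base rangeI)
    then show ?case by simp
  next
    case (step i \<alpha>)
    show ?case using var[OF step, of i] by (simp add: mult_single)
  qed
  have "p \<in> ?S" for p
  proof (induction p rule: mpol_induct)
    case (single \<alpha> c)
    show ?case using mpol.span_scale[OF one[of \<alpha>], of c] by simp
  qed (rule mpol.span_add)
  then show ?thesis by blast
qed

lemma mp_ideal_diff: "mp_ideal J \<Longrightarrow> p \<in> J \<Longrightarrow> q \<in> J \<Longrightarrow> p - q \<in> J"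
  unfolding mp_ideal_def by (metis diff_conv_add_uminus mult_1 mult_minus_left)

lemma mp_ideal_smult: "mp_ideal J \<Longrightarrow> p \<in> J \<Longrightarrow> mp_smult c p \<in> J"
  by (simp add: mp_ideal_def mp_smult_conv_mult)

lemma mp_ideal_subspace: "mp_ideal J \<Longrightarrow> mpol.subspace J"
  by (simp add: mpol.subspace_def mp_ideal_smult) (simp add: mp_ideal_def)

text \<open>
  Such a functional annihilates \<open>(z - w)\<^sup>\<beta>\<close> as soon as some \<open>\<beta>\<^sub>i \<ge> n\<^sub>i\<close>, so it is a finite combination of
  Taylor coefficients at \<open>w\<close>, that is, of derivatives at \<open>w\<close>.
\<close>

lemma functional_killing_powers_eq_diff_pairing:
  fixes w :: "complex^('m::{finite,linorder})"
  assumes J: "mp_ideal J" and pow: "\<And>i. shifted_var w i ^ n i \<in> J"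
    and lin: "Vector_Spaces.linear mp_smult (*) \<Phi>" and zero: "\<And>p. p \<in> J \<Longrightarrow> \<Phi> p = 0"
  shows "\<exists>q. \<forall>p. \<Phi> p = diff_pairing w q p"
proof -
  obtain c where c0: "\<And>\<beta>. c \<beta> \<noteq> 0" and
    c: "\<And>\<beta> \<alpha>. mp_eval (multi_deriv mp_diff \<alpha> (shifted_monomial w \<beta>)) w = (if \<alpha> = \<beta> then c \<beta> else 0)"
    using deriv_shifted_monomial_at_center[of w] by metis
  \<comment> \<open>Outside this finite box of exponents the functional vanishes on the shifted monomials.\<close>
  define B where "B = {\<beta> :: 'm \<Rightarrow>\<^sub>0 nat. \<forall>i. Poly_Mapping.lookup \<beta> i < n i}"
  have "finite (Poly_Mapping.lookup ` B)"
    by (rule finite_subset[of _ "PiE UNIV (\<lambda>i. {..<n i})"]) (auto simp: B_def intro!: finite_PiE)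
  then have finB: "finite B"
    by (rule finite_imageD) (auto intro!: inj_onI poly_mapping_eqI)
  define q where "q = (\<Sum>\<beta>\<in>B. Poly_Mapping.single \<beta> (\<Phi> (shifted_monomial w \<beta>) / c \<beta>))"
  have agree: "diff_pairing w q (shifted_monomial w \<gamma>) = \<Phi> (shifted_monomial w \<gamma>)" for \<gamma>
  proof -
    have "diff_pairing w q (shifted_monomial w \<gamma>) =
        (\<Sum>\<beta>\<in>B. if \<beta> = \<gamma> then \<Phi> (shifted_monomial w \<gamma>) else 0)"
      unfolding diff_pairing_eq_lin q_def mp_lin_sum
      by (intro sum.cong) (use c0 in \<open>auto simp: c\<close>)
    also have "\<dots> = (if \<gamma> \<in> B then \<Phi> (shifted_monomial w \<gamma>) else 0)"
      using finB by simp
    also have "\<dots> = \<Phi> (shifted_monomial w \<gamma>)"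
    proof (cases "\<gamma> \<in> B")
      case False
      then obtain i where i: "n i \<le> Poly_Mapping.lookup \<gamma> i" by (auto simp: B_def not_less)
      let ?r = "(\<Prod>j\<in>UNIV - {i}. shifted_var w j ^ Poly_Mapping.lookup \<gamma> j)"
      have "shifted_monomial w \<gamma> =
          (?r * shifted_var w i ^ (Poly_Mapping.lookup \<gamma> i - n i)) * shifted_var w i ^ n i"
      proof -
        have "shifted_monomial w \<gamma> = shifted_var w i ^ Poly_Mapping.lookup \<gamma> i * ?r"
          unfolding shifted_monomial_def by (rule prod.remove) auto
        also have "shifted_var w i ^ Poly_Mapping.lookup \<gamma> i =
            shifted_var w i ^ (Poly_Mapping.lookup \<gamma> i - n i) * shifted_var w i ^ n i"
          using i by (simp flip: power_add)
        finally show ?thesis by (simp only: mult_ac)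
      qed
      then have "shifted_monomial w \<gamma> \<in> J" using J pow[of i] by (simp add: mp_ideal_def)
      then show ?thesis using zero False by simp
    qed simp
    finally show ?thesis .
  qed
  have "\<Phi> p = diff_pairing w q p" for p
  proof -
    interpret vector_space_pair mp_smult "(*) :: complex \<Rightarrow> complex \<Rightarrow> complex"
      by unfold_locales (auto simp: algebra_simps)
    show ?thesis
      by (rule linear_eq_on[OF lin diff_pairing_linear[of w q], of p "range (shifted_monomial w)"])
         (use agree span_shifted_monomials[of w] in auto)
  qed
  then show ?thesis by blast
qed


section \<open>Noetherianity and functionals on an ideal\<close>

lemma nat_seq_mono_subseq:
  fixes f :: "nat \<Rightarrow> nat"
  shows "\<exists>r :: nat \<Rightarrow> nat. strict_mono r \<and> mono (f \<circ> r)"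
proof -
  obtain r where r: "strict_mono r" "monoseq (f \<circ> r)"
    using seq_monosub[of f] by (auto simp: comp_def)
  show ?thesis
  proof (cases "incseq (f \<circ> r)")
    case True
    then show ?thesis using r by blast
  next
    case False
    then have dec: "decseq (f \<circ> r)" using r(2) by (simp add: monoseq_iff)
    define m where "m = (LEAST m. m \<in> range (f \<circ> r))"
    have "m \<in> range (f \<circ> r)" unfolding m_def by (rule LeastI[of _ "(f \<circ> r) 0"]) blast
    then obtain N where N: "(f \<circ> r) N = m" by auto
    have "(f \<circ> r) n = m" if "N \<le> n" for n
    proof (rule antisym)
      show "(f \<circ> r) n \<le> m" using decseqD[OF dec that] N by simp
      show "m \<le> (f \<circ> r) n" unfolding m_def by (rule Least_le) blast
    qed
    then have "mono (f \<circ> (\<lambda>n. r (n + N)))" by (auto intro!: monoI)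
    moreover have "strict_mono (\<lambda>n. r (n + N))" using r(1) by (simp add: strict_mono_def)
    ultimately show ?thesis by blast
  qed
qed

text \<open>
  Dickson's lemma: passing to a subsequence once for each of the finitely many coordinates makes every coordinate
  nondecreasing.
\<close>

lemma dickson:
  fixes s :: "nat \<Rightarrow> ('m::finite \<Rightarrow>\<^sub>0 nat)"
  shows "\<exists>i j \<gamma>. i < j \<and> s j = \<gamma> + s i"
proof -
  have "\<exists>r :: nat \<Rightarrow> nat. strict_mono r \<and> (\<forall>i\<in>A. mono (\<lambda>n. Poly_Mapping.lookup (s (r n)) i))"
    if "finite A" for A :: "'m set"
    using that
  proof induction
    case empty
    show ?case by (intro exI[of _ id]) (simp add: strict_mono_def)
  next
    case (insert i A)
    then obtain r :: "nat \<Rightarrow> nat" where r: "strict_mono r" "\<forall>i\<in>A. mono (\<lambda>n. Poly_Mapping.lookup (s (r n)) i)"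
      by blast
    obtain r' :: "nat \<Rightarrow> nat" where r': "strict_mono r'" "mono ((\<lambda>n. Poly_Mapping.lookup (s (r n)) i) \<circ> r')"
      using nat_seq_mono_subseq by blast
    show ?case
    proof (intro exI[of _ "r \<circ> r'"] conjI ballI)
      show "strict_mono (r \<circ> r')" using r(1) r'(1) by (rule strict_mono_o)
      fix k assume "k \<in> insert i A"
      then show "mono (\<lambda>n. Poly_Mapping.lookup (s ((r \<circ> r') n)) k)"
        using r(2) r' by (auto simp: comp_def mono_def strict_mono_less_eq)
    qed
  qed
  from this[of UNIV] obtain r :: "nat \<Rightarrow> nat" where r: "strict_mono r"
    "\<And>i. mono (\<lambda>n. Poly_Mapping.lookup (s (r n)) i)" by auto
  have le: "Poly_Mapping.lookup (s (r 0)) i \<le> Poly_Mapping.lookup (s (r 1)) i" for i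
    using r(2)[of i] by (simp add: mono_def)
  have "s (r 1) = (s (r 1) - s (r 0)) + s (r 0)"
    by (rule poly_mapping_eqI) (use le in \<open>simp add: lookup_add lookup_minus\<close>)
  moreover have "r 0 < r 1" using r(1) by (simp add: strict_mono_def)
  ultimately show ?thesis by blast
qed

lemma exponent_nonneg:
  fixes \<gamma> :: "'m::linorder \<Rightarrow>\<^sub>0 nat"
  shows "0 \<le> \<gamma>"
proof (cases "\<gamma> = 0")
  case False
  then have ne: "Poly_Mapping.keys \<gamma> \<noteq> {}" by simp
  define k where "k = Min (Poly_Mapping.keys \<gamma>)"
  have k: "k \<in> Poly_Mapping.keys \<gamma>" unfolding k_def by (rule Min_in) (use ne in auto)
  have "k' \<notin> Poly_Mapping.keys \<gamma>" if "k' < k" for k'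
    using that Min_le[of "Poly_Mapping.keys \<gamma>" k'] unfolding k_def by (auto simp flip: not_less)
  then have "0 < \<gamma>"
    unfolding less_poly_mapping.rep_eq less_fun_def
    using k by (intro exI[of _ k]) (auto simp: in_keys_iff)
  then show ?thesis by simp
qed simp

text \<open>
  The library order on exponents is lexicographic and extends divisibility, so Dickson's lemma forbids infinite
  descent. It serves as a monomial order.
\<close>

lemma exponent_order_wf: "wf {(\<alpha> :: 'm::{finite,linorder} \<Rightarrow>\<^sub>0 nat, \<beta>). \<alpha> < \<beta>}"
  unfolding wf_iff_no_infinite_down_chain
proof safe
  fix s :: "nat \<Rightarrow> ('m \<Rightarrow>\<^sub>0 nat)"
  assume "\<forall>i. (s (Suc i), s i) \<in> {(\<alpha>, \<beta>). \<alpha> < \<beta>}"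
  then have dec: "s j < s i" if "i < j" for i j
    using that lift_Suc_mono_less[of "\<lambda>n. s n" i j]
    by (induction j) (auto simp: less_Suc_eq intro: less_trans)
  obtain i j \<gamma> where "i < j" "s j = \<gamma> + s i" using dickson by blast
  then show False
    using dec[of i j] add_right_mono[OF exponent_nonneg[of \<gamma>], of "s i"] by simp
qed

lemma keys_single_mult:
  "Poly_Mapping.keys (Poly_Mapping.single \<gamma> c * p) \<subseteq> (\<lambda>\<alpha>. \<gamma> + \<alpha>) ` Poly_Mapping.keys p"
  using keys_mult[of "Poly_Mapping.single \<gamma> c" p] by (auto split: if_splits)

lemma lookup_single_mult:
  fixes \<gamma> :: "'m \<Rightarrow>\<^sub>0 nat" and p :: "'m mpol"
  shows "Poly_Mapping.lookup (Poly_Mapping.single \<gamma> c * p) (\<gamma> + \<alpha>) = c * Poly_Mapping.lookup p \<alpha>"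
  by (induction p rule: mpol_induct)
     (auto simp: mult_single lookup_single when_def distrib_left lookup_add)

text \<open>
  Hilbert's basis theorem. In each difference \<open>J\<^sub>n\<^sub>+\<^sub>1 - J\<^sub>n\<close> take a polynomial with smallest leading exponent. By
  Dickson's lemma a later leading monomial is a multiple of an earlier one, and subtracting that multiple gives an
  element of the same difference with a smaller leading exponent.
\<close>

lemma mp_ideal_no_ascending_chain:
  fixes J :: "nat \<Rightarrow> ('m::{finite,linorder}) mpol set"
  assumes ideal: "\<And>n. mp_ideal (J n)" and sub: "\<And>n. J n \<subset> J (Suc n)"
  shows False
proof -
  \<comment> \<open>The leading exponent; it is used for nonzero polynomials only.\<close>
  define lead where "lead p = Max (Poly_Mapping.keys p)" for p :: "'m mpol"
  have "\<exists>p. p \<in> J (Suc n) - J n \<and> (\<forall>p'\<in>J (Suc n) - J n. \<not> lead p' < lead p)" for n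
  proof -
    obtain p0 where "p0 \<in> J (Suc n) - J n" using sub[of n] by blast
    with wf_inv_image[OF exponent_order_wf, of lead] show ?thesis
      by (rule wfE_min) auto
  qed
  then obtain p where p: "\<And>n. p n \<in> J (Suc n) - J n"
    and min: "\<And>n p'. p' \<in> J (Suc n) - J n \<Longrightarrow> \<not> lead p' < lead (p n)"
    by metis
  obtain i j \<gamma> where ij: "i < j" "lead (p j) = \<gamma> + lead (p i)"
    using dickson[of "\<lambda>n. lead (p n)"] by blast
  have mono: "J a \<subseteq> J b" if "a \<le> b" for a b
    using that by (rule lift_Suc_mono_le[rotated]) (use sub in blast)
  have ne: "Poly_Mapping.keys (p n) \<noteq> {}" for n
    using p[of n] ideal[of n] by (auto simp: mp_ideal_def)
  have lead_in: "lead (p n) \<in> Poly_Mapping.keys (p n)" for n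
    unfolding lead_def by (rule Max_in) (use ne in auto)
  have lead_ge: "\<alpha> \<le> lead r" if "\<alpha> \<in> Poly_Mapping.keys r" for \<alpha> r
    unfolding lead_def by (rule Max_ge) (use that in auto)
  define c where "c = Poly_Mapping.lookup (p j) (lead (p j)) / Poly_Mapping.lookup (p i) (lead (p i))"
  \<comment> \<open>The multiple of \<open>p i\<close> that has the same leading term as \<open>p j\<close>.\<close>
  define s where "s = Poly_Mapping.single \<gamma> c * p i"
  define r where "r = p j - s"
  have "p i \<in> J j" using p[of i] mono[of "Suc i" j] ij(1) by auto
  then have s: "s \<in> J j" using ideal[of j] by (simp add: s_def mp_ideal_def)
  have "r \<notin> J j"
  proof
    assume "r \<in> J j"
    then have "r + s \<in> J j" using s ideal[of j] by (simp add: mp_ideal_def)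
    then show False using p[of j] by (simp add: r_def)
  qed
  moreover have "r \<in> J (Suc j)"
    unfolding r_def by (rule mp_ideal_diff[OF ideal]) (use p[of j] s sub[of j] in auto)
  ultimately have r: "r \<in> J (Suc j) - J j" by simp
  have "lead r \<in> Poly_Mapping.keys r"
    unfolding lead_def by (rule Max_in) (use r ideal[of j] in \<open>auto simp: mp_ideal_def\<close>)
  moreover have "\<alpha> < lead (p j)" if "\<alpha> \<in> Poly_Mapping.keys r" for \<alpha>
  proof -
    have "\<alpha> \<noteq> lead (p j)"
    proof
      assume "\<alpha> = lead (p j)"
      then have "Poly_Mapping.lookup r \<alpha> = 0"
        using lead_in[of i] ij(2)
        by (simp add: r_def s_def lookup_minus lookup_single_mult c_def in_keys_iff)
      then show False using that by (simp add: in_keys_iff)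
    qed
    moreover have "\<alpha> \<le> lead (p j)"
    proof (cases "\<alpha> \<in> Poly_Mapping.keys (p j)")
      case False
      then have "\<alpha> \<in> Poly_Mapping.keys s"
        using that by (auto simp: r_def in_keys_iff lookup_minus)
      then obtain \<beta> where "\<beta> \<in> Poly_Mapping.keys (p i)" "\<alpha> = \<gamma> + \<beta>"
        using keys_single_mult unfolding s_def by blast
      then show ?thesis using lead_ge[of \<beta> "p i"] ij(2) by (simp add: add_left_mono)
    qed (rule lead_ge)
    ultimately show ?thesis by simp
  qed
  ultimately show False using min[OF r] by simp
qed

lemma mp_ideal_wf: "wf {(J, J'). mp_ideal J \<and> mp_ideal J' \<and> J' \<subset> (J :: ('m::{finite,linorder}) mpol set)}"
  unfolding wf_iff_no_infinite_down_chain
proof safe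
  fix s :: "nat \<Rightarrow> 'm mpol set"
  assume "\<forall>i. (s (Suc i), s i) \<in> {(J, J'). mp_ideal J \<and> mp_ideal J' \<and> J' \<subset> J}"
  then show False by (intro mp_ideal_no_ascending_chain[of s]) auto
qed

text \<open>
  A form of the Artin-Rees lemma, by the usual proof of Krull's intersection theorem. Let \<open>J\<close> be maximal with
  \<open>J \<inter> I = M\<close>. For \<open>x = x\<^sub>i\<close> the ideals \<open>(J : x\<^sup>n)\<close> become stationary at some \<open>n\<close>, and then
  \<open>J + (x\<^sup>n)\<close> still meets \<open>I\<close> in \<open>M\<close>, so \<open>x\<^sup>n \<in> J\<close> by maximality.
\<close>

lemma exists_ideal_containing_powers:
  fixes I M :: "('m::{finite,linorder}) mpol set" and x :: "'i \<Rightarrow> 'm mpol"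
  assumes I: "mp_ideal I" and M: "mp_ideal M" "M \<subseteq> I" and xM: "\<And>i p. p \<in> I \<Longrightarrow> x i * p \<in> M"
  shows "\<exists>J n. mp_ideal J \<and> J \<inter> I = M \<and> (\<forall>i. x i ^ n i \<in> J)"
proof -
  let ?S = "{J. mp_ideal J \<and> J \<inter> I = M}"
  have "M \<in> ?S" using M by auto
  then obtain J where J: "J \<in> ?S"
    and "\<And>J'. (J', J) \<in> {(J, J'). mp_ideal J \<and> mp_ideal J' \<and> J' \<subset> J} \<Longrightarrow> J' \<notin> ?S"
    using mp_ideal_wf[where 'm = 'm] unfolding wf_eq_minimal by meson
  then have max: "J' = J" if "mp_ideal J'" "J' \<inter> I = M" "J \<subseteq> J'" for J'
    using that by blast
  have idJ: "mp_ideal J" and JI: "J \<inter> I = M" using J by auto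
  have "\<exists>n. x i ^ n \<in> J" for i
  proof -
    \<comment> \<open>The colon ideal \<open>(J : x\<^sub>i\<^sup>n)\<close>.\<close>
    define C where "C n = {r. x i ^ n * r \<in> J}" for n
    have idC: "mp_ideal (C n)" for n
      using idJ by (auto simp: mp_ideal_def C_def distrib_left mult.left_commute)
    have sub: "C n \<subseteq> C (Suc n)" for n
      using idJ by (auto simp: mp_ideal_def C_def mult.assoc)
    obtain n where n: "C (Suc n) = C n"
      using mp_ideal_no_ascending_chain[of C, OF idC] sub by blast
    \<comment> \<open>The ideal \<open>J + (x\<^sub>i\<^sup>n)\<close>.\<close>
    define J' where "J' = {a + x i ^ n * r | a r. a \<in> J}"
    have zero: "0 \<in> J" using idJ by (simp add: mp_ideal_def)
    have idJ': "mp_ideal J'"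
      unfolding mp_ideal_def
    proof (intro conjI ballI allI)
      show "0 \<in> J'" using zero unfolding J'_def by (force intro: exI[of _ 0])
    next
      fix p q assume "p \<in> J'" "q \<in> J'"
      then obtain a r b s where "p = a + x i ^ n * r" "q = b + x i ^ n * s" "a \<in> J" "b \<in> J"
        unfolding J'_def by blast
      then have "p + q = (a + b) + x i ^ n * (r + s)" "a + b \<in> J"
        using idJ by (auto simp: mp_ideal_def algebra_simps)
      then show "p + q \<in> J'" unfolding J'_def by blast
    next
      fix u p assume "p \<in> J'"
      then obtain a r where "p = a + x i ^ n * r" "a \<in> J"
        unfolding J'_def by blast
      then have "u * p = u * a + x i ^ n * (u * r)" "u * a \<in> J"
        using idJ by (simp add: algebra_simps, simp add: mp_ideal_def)
      then show "u * p \<in> J'" unfolding J'_def by blast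
    qed
    have JJ': "J \<subseteq> J'"
    proof
      fix a assume "a \<in> J"
      moreover have "a = a + x i ^ n * 0" by simp
      ultimately show "a \<in> J'" unfolding J'_def by blast
    qed
    have "J' \<inter> I \<subseteq> J"
    proof
      fix p assume p: "p \<in> J' \<inter> I"
      then obtain a r where ar: "p = a + x i ^ n * r" "a \<in> J" unfolding J'_def by blast
      have "x i * p \<in> J" using xM[of p i] p JI by auto
      moreover have "x i * a \<in> J" using ar idJ by (simp add: mp_ideal_def)
      moreover have "x i ^ Suc n * r = x i * p - x i * a"
        using ar by (simp add: algebra_simps)
      ultimately have "r \<in> C (Suc n)" using mp_ideal_diff[OF idJ] by (simp add: C_def)
      then have "r \<in> C n" using n by simp
      then have "x i ^ n * r \<in> J" by (simp add: C_def)
      then show "p \<in> J" using ar idJ by (simp add: mp_ideal_def)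
    qed
    then have "J' \<inter> I = M" using JI JJ' by blast
    then have "J' = J" using max idJ' JJ' by blast
    moreover have "x i ^ n = 0 + x i ^ n * 1" by simp
    then have "x i ^ n \<in> J'" unfolding J'_def using zero by blast
    ultimately show ?thesis by blast
  qed
  then show ?thesis using idJ JI by metis
qed

text \<open>
  The prescription \<open>f\<close> on \<open>V\<close> and \<open>0\<close> on \<open>W\<close> is consistent. A basis of \<open>W\<close> is completed to one of
  \<open>V + W\<close> by vectors of \<open>V\<close>, and the values are prescribed on that basis.
\<close>

lemma (in vector_space) linear_functional_extension:
  assumes V: "subspace V" and W: "subspace W"
    and add: "\<And>u v. u \<in> V \<Longrightarrow> v \<in> V \<Longrightarrow> f (u + v) = f u + f v"
    and scale: "\<And>c v. v \<in> V \<Longrightarrow> f (scale c v) = c * f v"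
    and zero: "\<And>v. v \<in> V \<Longrightarrow> v \<in> W \<Longrightarrow> f v = 0"
  shows "\<exists>g. Vector_Spaces.linear scale (*) g \<and> (\<forall>v\<in>V. g v = f v) \<and> (\<forall>w\<in>W. g w = 0)"
proof -
  interpret vector_space_pair scale "(*)"
    by unfold_locales (auto simp: algebra_simps)
  obtain B where B: "B \<subseteq> W" "independent B" "W \<subseteq> span B"
    using basis_exists[of W] by metis
  obtain B' where B': "B \<subseteq> B'" "B' \<subseteq> V \<union> W" "independent B'" "V \<union> W \<subseteq> span B'"
    using maximal_independent_subset_extend[of B "V \<union> W"] B by auto
  obtain g where g: "Vector_Spaces.linear scale (*) g" "\<And>b. b \<in> B' \<Longrightarrow> g b = (if b \<in> B then 0 else f b)"
    using linear_independent_extend[OF B'(3), of "\<lambda>b. if b \<in> B then 0 else f b"] by auto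
  interpret g: Vector_Spaces.linear scale "(*)" g by (rule g(1))
  have spanB: "span B = W" using span_minimal[OF B(1) W] B(3) by blast
  have gW: "g w = 0" if "w \<in> W" for w
    using that unfolding spanB[symmetric]
  proof (induction rule: span_induct_alt)
    case (step c b w)
    then show ?case using g(2)[of b] B'(1) by (auto simp: g.add g.scale)
  qed (rule g.zero)
  have BV: "B' - B \<subseteq> V"
  proof
    fix b assume b: "b \<in> B' - B"
    have "b \<notin> W"
    proof
      assume "b \<in> W"
      then have "b \<in> span (B' - {b})"
        using span_mono[of B "B' - {b}"] B'(1) b spanB by auto
      then show False using B'(3) b by (auto simp: dependent_def)
    qed
    then show "b \<in> V" using b B'(2) by auto
  qed
  have gC: "x \<in> V \<and> g x = f x" if "x \<in> span (B' - B)" for x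
    using that
  proof (induction rule: span_induct_alt)
    case base
    show ?case using scale[of 0 0] subspace_0[OF V] by (simp add: g.zero)
  next
    case (step c b x)
    then have b: "b \<in> V" "g b = f b" using g(2)[of b] BV by auto
    then show ?case
      using step V add[of "scale c b" x] scale[of b c] by (auto simp: g.add g.scale subspace_add subspace_scale)
  qed
  have "g v = f v" if v: "v \<in> V" for v
  proof -
    have "v \<in> span (B \<union> (B' - B))" using v B'(1,4) by (auto simp: Un_absorb1)
    then obtain w x where wx: "v = w + x" "w \<in> W" "x \<in> span (B' - B)"
      unfolding span_Un spanB by blast
    have "w \<in> V" using gC[OF wx(3)] v wx(1) subspace_diff[OF V, of v x] by simp
    then have "f v = f x" using add[of w x] gC[OF wx(3)] zero[of w] wx by simp
    then show ?thesis using gC[OF wx(3)] gW[OF wx(2)] wx by (simp add: g.add)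
  qed
  then show ?thesis using g(1) gW by blast
qed

text \<open>
  The ideal \<open>M\<close> in the proof is \<open>\<mm> I\<close> for the maximal ideal \<open>\<mm>\<close> at \<open>w\<close>. The functional kills it, so it
  extends by \<open>0\<close> to an ideal that meets \<open>I\<close> in \<open>M\<close> and contains a power of each \<open>z\<^sub>i - w\<^sub>i\<close>.
\<close>

lemma ideal_functional_eq_diff_pairing:
  fixes w :: "complex^('m::{finite,linorder})"
  assumes I: "mp_ideal I"
    and add: "\<And>p p'. p \<in> I \<Longrightarrow> p' \<in> I \<Longrightarrow> \<phi> (p + p') = \<phi> p + \<phi> p'"
    and scale: "\<And>c p. p \<in> I \<Longrightarrow> \<phi> (mp_smult c p) = c * \<phi> p"
    and zero: "\<And>j p. p \<in> I \<Longrightarrow> \<phi> (shifted_var w j * p) = 0"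
  shows "\<exists>q. \<forall>p\<in>I. \<phi> p = diff_pairing w q p"
proof -
  define M where "M = {\<Sum>j\<in>UNIV. shifted_var w j * p j | p. \<forall>j. p j \<in> I}"
  have I0: "0 \<in> I" and Iadd: "\<And>p p'. p \<in> I \<Longrightarrow> p' \<in> I \<Longrightarrow> p + p' \<in> I"
    and Imult: "\<And>r p. p \<in> I \<Longrightarrow> r * p \<in> I"
    using I by (auto simp: mp_ideal_def)
  have sum: "sum f A \<in> I \<and> \<phi> (sum f A) = (\<Sum>a\<in>A. \<phi> (f a))" if "\<And>a. f a \<in> I" for f and A :: "'m set"
    using scale[OF I0, of 0] I0 that
    by (induction A rule: infinite_finite_induct) (auto simp: add Iadd)
  have MI: "M \<subseteq> I" using sum Imult by (auto simp: M_def)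
  have \<phi>M: "\<phi> p = 0" if "p \<in> M" for p
    using that sum[of "\<lambda>j. shifted_var w j * _ j" UNIV] Imult zero by (auto simp: M_def sum)
  have "mp_ideal M"
    unfolding mp_ideal_def
  proof (intro conjI ballI allI)
    show "0 \<in> M" using I0 unfolding M_def by (intro CollectI exI[of _ "\<lambda>_. 0"]) simp
  next
    fix a b assume "a \<in> M" "b \<in> M"
    then obtain p p' where "a = (\<Sum>j\<in>UNIV. shifted_var w j * p j)" "\<forall>j. p j \<in> I"
      "b = (\<Sum>j\<in>UNIV. shifted_var w j * p' j)" "\<forall>j. p' j \<in> I"
      by (auto simp: M_def)
    then show "a + b \<in> M" unfolding M_def
      by (intro CollectI exI[of _ "\<lambda>j. p j + p' j"]) (auto simp: sum.distrib distrib_left Iadd)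
  next
    fix r a assume "a \<in> M"
    then obtain p where "a = (\<Sum>j\<in>UNIV. shifted_var w j * p j)" "\<forall>j. p j \<in> I"
      by (auto simp: M_def)
    then show "r * a \<in> M" unfolding M_def
      by (intro CollectI exI[of _ "\<lambda>j. r * p j"])
         (auto simp: sum_distrib_left Imult mult.left_commute)
  qed
  moreover have "shifted_var w i * p \<in> M" if "p \<in> I" for i p
    unfolding M_def
    by (intro CollectI exI[of _ "\<lambda>j. if j = i then p else 0"]) (use that I0 in \<open>auto simp: if_distrib cong: if_cong\<close>)
  ultimately obtain J n where J: "mp_ideal J" "J \<inter> I = M" "\<And>i. shifted_var w i ^ n i \<in> J"
    using exists_ideal_containing_powers[OF I _ MI, of "shifted_var w"] by blast
  obtain \<Phi> where \<Phi>: "Vector_Spaces.linear mp_smult (*) \<Phi>" "\<And>p. p \<in> I \<Longrightarrow> \<Phi> p = \<phi> p" "\<And>p. p \<in> J \<Longrightarrow> \<Phi> p = 0"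
    using mpol.linear_functional_extension[OF mp_ideal_subspace[OF I] mp_ideal_subspace[OF J(1)], of \<phi>]
      add scale \<phi>M J(2) by blast
  obtain q where "\<And>p. \<Phi> p = diff_pairing w q p"
    using functional_killing_powers_eq_diff_pairing[OF J(1,3) \<Phi>(1,3)] by blast
  then show ?thesis using \<Phi>(2) by metis
qed


section \<open>Hilbert spaces inside a vector space\<close>

text \<open>
  A complex Hilbert space given as a subspace \<open>H\<close> of an ambient vector space together with an inner product that is
  meaningful on \<open>H\<close> only, as for spaces of functions with an abstract inner product. The norm is \<^const>\<open>hnorm\<close>.
\<close>

locale hilbert_on = vector_space scale
  for scale :: "complex \<Rightarrow> 'v \<Rightarrow> 'v::ab_group_add" +
  fixes H :: "'v set" and ip :: "'v \<Rightarrow> 'v \<Rightarrow> complex"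
  assumes subspace_H: "subspace H"
    and ip_add_left: "\<And>f g h. f \<in> H \<Longrightarrow> g \<in> H \<Longrightarrow> h \<in> H \<Longrightarrow> ip (f + g) h = ip f h + ip g h"
    and ip_scale_left: "\<And>c f g. f \<in> H \<Longrightarrow> g \<in> H \<Longrightarrow> ip (scale c f) g = c * ip f g"
    and ip_commute: "\<And>f g. f \<in> H \<Longrightarrow> g \<in> H \<Longrightarrow> ip g f = cnj (ip f g)"
    and ip_pos: "\<And>f. f \<in> H \<Longrightarrow> f \<noteq> 0 \<Longrightarrow> 0 < Re (ip f f)"
    and complete: "\<And>s. (\<And>n. s n \<in> H) \<Longrightarrow>
      (\<And>e. e > 0 \<Longrightarrow> \<exists>N. \<forall>k\<ge>N. \<forall>n\<ge>N. hnorm ip (s k - s n) < e) \<Longrightarrow>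
      \<exists>f\<in>H. (\<lambda>n. hnorm ip (s n - f)) \<longlonglongrightarrow> 0"
begin

abbreviation nrm :: "'v \<Rightarrow> real" where "nrm \<equiv> hnorm ip"

lemmas H_add = subspace_add[OF subspace_H]
lemmas H_scale = subspace_scale[OF subspace_H]
lemmas H_diff = subspace_diff[OF subspace_H]
lemmas H_zero = subspace_0[OF subspace_H]

lemma ip_diff_left:
  assumes "f \<in> H" "g \<in> H" "h \<in> H"
  shows "ip (f - g) h = ip f h - ip g h"
  using ip_add_left[of "f - g" g h] assms H_diff by simp

lemma ip_zero_left [simp]: "h \<in> H \<Longrightarrow> ip 0 h = 0"
  using ip_diff_left[of h h h] by simp

lemma ip_zero_right [simp]: "h \<in> H \<Longrightarrow> ip h 0 = 0"
  using ip_commute[of 0 h] H_zero by simp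

lemma ip_add_right:
  assumes "f \<in> H" "g \<in> H" "h \<in> H"
  shows "ip h (f + g) = ip h f + ip h g"
  using assms H_add ip_commute[of _ h] by (simp add: ip_add_left)

lemma ip_diff_right:
  assumes "f \<in> H" "g \<in> H" "h \<in> H"
  shows "ip h (f - g) = ip h f - ip h g"
  using assms H_diff ip_commute[of _ h] by (simp add: ip_diff_left)

lemma ip_scale_right:
  assumes "f \<in> H" "g \<in> H"
  shows "ip g (scale c f) = cnj c * ip g f"
  using assms H_scale ip_commute[of _ g] by (simp add: ip_scale_left)

lemma ip_self: 
  assumes "f \<in> H"
  shows "ip f f = complex_of_real ((nrm f)\<^sup>2)" "Re (ip f f) = (nrm f)\<^sup>2" 
proof -
  have "0 \<le> Re (ip f f)" using ip_pos[OF assms] assms by (cases "f = 0") auto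
  then show *: "Re (ip f f) = (nrm f)\<^sup>2" by (simp add: hnorm_def)
  have "Im (ip f f) = 0" using ip_commute[OF assms assms] by (metis Reals_cnj_iff complex_is_Real_iff)
  then show "ip f f = complex_of_real ((nrm f)\<^sup>2)" using * by (simp add: complex_eq_iff)
qed

lemma nrm_nonneg: "f \<in> H \<Longrightarrow> 0 \<le> nrm f"
  using ip_pos[of f] by (cases "f = 0") (auto simp: hnorm_def)

lemma nrm_zero [simp]: "nrm 0 = 0"
  using H_zero by (simp add: hnorm_def)

lemma nrm_pos: "f \<in> H \<Longrightarrow> f \<noteq> 0 \<Longrightarrow> 0 < nrm f"
  using ip_pos[of f] by (simp add: hnorm_def)

lemma nrm_scale: 
  assumes "f \<in> H" shows "nrm (scale c f) = cmod c * nrm f"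
proof -
  have "ip (scale c f) (scale c f) = (c * cnj c) * ip f f"
    using assms H_scale by (simp add: ip_scale_left ip_scale_right)
  also have "\<dots> = complex_of_real ((cmod c * nrm f)\<^sup>2)"
    by (simp only: ip_self(1)[OF assms] complex_mult_cnj cmod_power2 power_mult_distrib of_real_mult)
  finally have "(nrm (scale c f))\<^sup>2 = (cmod c * nrm f)\<^sup>2"
    using ip_self(2)[of "scale c f"] assms H_scale by simp
  then show ?thesis using nrm_nonneg assms H_scale by simp
qed

lemma nrm_add_sq:
  assumes "f \<in> H" "g \<in> H"
  shows "(nrm (f + g))\<^sup>2 = (nrm f)\<^sup>2 + 2 * Re (ip f g) + (nrm g)\<^sup>2"
proof -
  have "Re (ip g f) = Re (ip f g)" using ip_commute[OF assms] by simp
  then show ?thesis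
    using assms H_add ip_self(2)[of "f + g"] ip_self(2)[of f] ip_self(2)[of g]
    by (simp add: ip_add_left ip_add_right)
qed

lemma nrm_minus_commute: "f \<in> H \<Longrightarrow> g \<in> H \<Longrightarrow> nrm (f - g) = nrm (g - f)"
  using nrm_scale[of "f - g" "-1"] H_diff by simp

lemma Cauchy_Schwarz:
  assumes f: "f \<in> H" and g: "g \<in> H"
  shows "cmod (ip f g) \<le> nrm f * nrm g"
proof (cases "g = 0")
  case False
  then have pos: "0 < nrm g" using nrm_pos g by simp
  define c where "c = - ip f g / (nrm g)\<^sup>2"
  have "cnj c * ip f g = complex_of_real (- (cmod (ip f g))\<^sup>2 / (nrm g)\<^sup>2)"
    by (simp add: c_def complex_norm_square mult.commute del: of_real_power)
  then have "Re (ip f (scale c g)) = - (cmod (ip f g))\<^sup>2 / (nrm g)\<^sup>2"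
    using f g by (simp only: ip_scale_right Re_complex_of_real)
  moreover have "(nrm (scale c g))\<^sup>2 = (cmod (ip f g))\<^sup>2 / (nrm g)\<^sup>2"
  proof -
    have "cmod c = cmod (ip f g) / (nrm g)\<^sup>2" by (simp add: c_def norm_divide norm_power)
    then show ?thesis using pos by (simp add: nrm_scale[OF g] power2_eq_square)
  qed
  ultimately have "(nrm (f + scale c g))\<^sup>2 = (nrm f)\<^sup>2 - (cmod (ip f g))\<^sup>2 / (nrm g)\<^sup>2"
    using nrm_add_sq[of f "scale c g"] f g H_scale by simp
  then have "(cmod (ip f g))\<^sup>2 / (nrm g)\<^sup>2 \<le> (nrm f)\<^sup>2"
    using zero_le_power2[of "nrm (f + scale c g)"] by linarith
  then have "(cmod (ip f g))\<^sup>2 \<le> (nrm f * nrm g)\<^sup>2"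
    using pos by (simp add: divide_le_eq power_mult_distrib)
  then show ?thesis by (rule power2_le_imp_le) (use nrm_nonneg f g in simp)
qed (use assms in simp)

lemma nrm_triangle:
  assumes "f \<in> H" "g \<in> H"
  shows "nrm (f + g) \<le> nrm f + nrm g"
proof -
  have "Re (ip f g) \<le> nrm f * nrm g"
    using Cauchy_Schwarz[OF assms] complex_Re_le_cmod[of "ip f g"] by linarith
  then have "(nrm (f + g))\<^sup>2 \<le> (nrm f + nrm g)\<^sup>2"
    using nrm_add_sq[OF assms] by (simp add: power2_sum)
  then show ?thesis by (rule power2_le_imp_le) (use nrm_nonneg assms in simp)
qed

lemma nrm_triangle_diff:
  assumes "f \<in> H" "g \<in> H" "h \<in> H"
  shows "nrm (f - h) \<le> nrm (f - g) + nrm (g - h)"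
  using nrm_triangle[of "f - g" "g - h"] assms H_diff by simp

lemma tendsto_ip:
  assumes s: "\<And>n. s n \<in> H" and f: "f \<in> H" and lim: "(\<lambda>n. nrm (s n - f)) \<longlonglongrightarrow> 0" and h: "h \<in> H"
  shows "(\<lambda>n. ip (s n) h) \<longlonglongrightarrow> ip f h"
proof -
  have "(\<lambda>n. nrm (s n - f) * nrm h) \<longlonglongrightarrow> 0"
    using tendsto_mult_left_zero[OF lim] by simp
  then have "(\<lambda>n. ip (s n) h - ip f h) \<longlonglongrightarrow> 0"
    by (rule Lim_null_comparison[rotated])
       (use Cauchy_Schwarz[of "s _ - f" h] s f h H_diff in \<open>auto simp: ip_diff_left\<close>)
  then show ?thesis by (rule LIM_zero_cancel)
qed

lemma tendsto_nrm_diff: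
  assumes s: "\<And>n. s n \<in> H" and f: "f \<in> H" and lim: "(\<lambda>n. nrm (s n - f)) \<longlonglongrightarrow> 0"
    and g: "g \<in> H" and le: "eventually (\<lambda>n. nrm (s n - g) \<le> b) sequentially"
  shows "nrm (f - g) \<le> b"
proof -
  have "(\<lambda>n. nrm (s n - f) + b) \<longlonglongrightarrow> 0 + b" by (intro tendsto_intros lim)
  moreover have "eventually (\<lambda>n. nrm (f - g) \<le> nrm (s n - f) + b) sequentially"
    using le
  proof eventually_elim
    case (elim n)
    then show ?case
      using nrm_triangle_diff[of f "s n" g] nrm_minus_commute[of f "s n"] s f g by simp
  qed
  ultimately show ?thesis
    using tendsto_lowerbound[of "\<lambda>n. nrm (s n - f) + b"] by simp
qed

text \<open>
  The representing vector minimises the functional \<open>J f = \<parallel>f\<parallel>\<^sup>2 / 2 - Re (\<phi> f)\<close>, which is bounded below since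
  \<open>\<phi>\<close> is bounded. The parallelogram law makes minimising sequences Cauchy, and the first variation at the limit
  gives \<open>Re (\<phi> h) = Re (ip g h)\<close>; replacing \<open>h\<close> by \<open>\<i> h\<close> gives the imaginary parts.
\<close>

lemma riesz_representation:
  assumes add: "\<And>f g. f \<in> H \<Longrightarrow> g \<in> H \<Longrightarrow> \<phi> (f + g) = \<phi> f + \<phi> g"
    and scale: "\<And>c f. f \<in> H \<Longrightarrow> \<phi> (scale c f) = c * \<phi> f"
    and bound: "\<And>f. f \<in> H \<Longrightarrow> cmod (\<phi> f) \<le> C * nrm f"
  shows "\<exists>g\<in>H. \<forall>f\<in>H. \<phi> f = ip f g"
proof -
  define J where "J f = (nrm f)\<^sup>2 / 2 - Re (\<phi> f)" for f
  define d where "d = Inf (J ` H)"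
  have J_bound: "- C\<^sup>2 / 2 \<le> J f" if "f \<in> H" for f
  proof -
    have "Re (\<phi> f) \<le> C * nrm f" using bound[OF that] complex_Re_le_cmod[of "\<phi> f"] by linarith
    moreover have "0 \<le> (nrm f - C)\<^sup>2" by simp
    ultimately show ?thesis by (simp add: J_def power2_diff mult_ac)
  qed
  then have bdd: "bdd_below (J ` H)" by (auto intro!: bdd_belowI)
  have d_le: "d \<le> J f" if "f \<in> H" for f
    unfolding d_def by (rule cInf_lower) (use that bdd in auto)
  have "\<exists>f\<in>H. J f < d + 1 / Suc n" for n
    using cInf_lessD[of "J ` H" "d + 1 / Suc n"] H_zero by (auto simp: d_def)
  then obtain s where s: "\<And>n. s n \<in> H" "\<And>n. J (s n) < d + 1 / Suc n" by metis
  have J_add: "J (f + h) = J f + J h + Re (ip f h)" if "f \<in> H" "h \<in> H" for f h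
    using that nrm_add_sq[of f h] by (simp add: J_def add)
  have J_scale: "J (scale (complex_of_real t) h) = t\<^sup>2 * (nrm h)\<^sup>2 / 2 - t * Re (\<phi> h)"
    if "h \<in> H" for t h
    using that by (simp add: J_def scale nrm_scale power_mult_distrib)
  have parallelogram: "(nrm (f - g))\<^sup>2 \<le> 4 * (J f + J g - 2 * d)" if fg: "f \<in> H" "g \<in> H" for f g
  proof -
    have "J (scale (complex_of_real (1/2)) (f + g)) = (nrm (f + g))\<^sup>2 / 8 - Re (\<phi> f + \<phi> g) / 2"
      using J_scale[of "f + g" "1/2"] fg H_add by (simp add: add power2_eq_square)
    moreover have "d \<le> J (scale (complex_of_real (1/2)) (f + g))"
      by (rule d_le) (use fg H_add H_scale in auto)
    moreover have "(nrm (f - g))\<^sup>2 = (nrm f)\<^sup>2 - 2 * Re (ip f g) + (nrm g)\<^sup>2"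
      using nrm_add_sq[of f "scale (-1) g"] fg H_scale[of g "-1"]
      by (simp add: ip_scale_right nrm_scale flip: scale_minus_left)
         (simp add: ip_scale_right[of g f "-1", simplified] nrm_scale[of g "-1", simplified])
    ultimately show ?thesis using nrm_add_sq[OF fg] by (simp add: J_def field_simps)
  qed
  have "\<exists>N. \<forall>k\<ge>N. \<forall>n\<ge>N. nrm (s k - s n) < e" if "e > 0" for e
  proof -
    obtain N where N: "8 / real (Suc N) < e\<^sup>2"
      using reals_Archimedean[of "e\<^sup>2 / 8"] \<open>e > 0\<close>
      by (auto simp: field_simps)
    show ?thesis
    proof (intro exI[of _ N] allI impI)
      fix k n assume kn: "N \<le> k" "N \<le> n"
      have "1 / real (Suc k) \<le> 1 / real (Suc N)" "1 / real (Suc n) \<le> 1 / real (Suc N)"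
        using kn by (auto simp: field_simps)
      then have "(nrm (s k - s n))\<^sup>2 < e\<^sup>2"
        using parallelogram[of "s k" "s n"] s(1)[of k] s(1)[of n] s(2)[of k] s(2)[of n] N by simp
      then show "nrm (s k - s n) < e" by (rule power2_less_imp_less) (use that in simp)
    qed
  qed
  then obtain g where g: "g \<in> H" "(\<lambda>n. nrm (s n - g)) \<longlonglongrightarrow> 0"
    using complete[of s] s(1) by blast
  have Re_eq: "Re (\<phi> h) = Re (ip g h)" if h: "h \<in> H" for h
  proof -
    define a where "a = Re (ip g h) - Re (\<phi> h)"
    define N where "N = (nrm h)\<^sup>2"
    have "0 \<le> t * a + t\<^sup>2 * N / 2" for t
    proof -
      have "(\<lambda>n. 1 / Suc n + t * (Re (ip (s n) h) - Re (\<phi> h)) + t\<^sup>2 * N / 2)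
          \<longlonglongrightarrow> 0 + t * a + t\<^sup>2 * N / 2"
        unfolding a_def
        by (intro tendsto_intros tendsto_Re tendsto_ip s g h LIMSEQ_Suc[OF lim_1_over_n])
      moreover have "0 \<le> 1 / Suc n + t * (Re (ip (s n) h) - Re (\<phi> h)) + t\<^sup>2 * N / 2" for n
      proof -
        have "d \<le> J (s n + scale (complex_of_real t) h)"
          by (rule d_le) (use s h H_add H_scale in auto)
        also have "\<dots> = J (s n) + (t\<^sup>2 * N / 2 - t * Re (\<phi> h)) + t * Re (ip (s n) h)"
          using s h H_scale by (simp add: J_add J_scale ip_scale_right N_def)
        finally show ?thesis using s(2)[of n] by (simp add: algebra_simps)
      qed
      ultimately show ?thesis by (intro LIMSEQ_le_const) auto
    qed
    \<comment> \<open>A quadratic in \<open>t\<close> with minimum \<open>0\<close> at \<open>t = 0\<close> has no linear term;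
      the value \<open>t = - a / (N + 1)\<close> works also when \<open>N = 0\<close>.\<close>
    note nonneg = this
    have N: "0 \<le> N" by (simp add: N_def)
    define u where "u = a / (N + 1)"
    have a: "a = u * (N + 1)" using N by (simp add: u_def)
    have "u\<^sup>2 * (N / 2 + 1) \<le> 0"
      using nonneg[of "- u"] by (simp add: a algebra_simps power2_eq_square)
    then have "u = 0" using N by (simp add: mult_le_0_iff)
    then have "a = 0" by (simp add: a)
    then show ?thesis by (simp add: a_def)
  qed
  have "\<phi> f = ip f g" if f: "f \<in> H" for f
  proof -
    have "Re (\<phi> (scale \<i> f)) = Re (ip g (scale \<i> f))" by (rule Re_eq) (use f H_scale in auto)
    then have "Im (\<phi> f) = - Im (ip g f)" using f g by (simp add: scale ip_scale_right)
    then show ?thesis using Re_eq[OF f] ip_commute[OF g(1) f] by (simp add: complex_eq_iff)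
  qed
  then show ?thesis using g by blast
qed

text \<open>
  Of \<open>x + u\<close> and \<open>x - u\<close>, with \<open>u\<close> the multiple of \<open>v\<close> of norm \<open>r\<close>, one will do: the two inner
  products with \<open>v\<close> differ by \<open>2 ip u v\<close>.
\<close>

lemma exists_near_large_ip:
  assumes x: "x \<in> H" and v: "v \<in> H" and r: "0 \<le> r"
  shows "\<exists>y\<in>H. nrm (y - x) \<le> r \<and> r * nrm v \<le> cmod (ip y v)"
proof (cases "v = 0")
  case False
  then have pos: "0 < nrm v" using nrm_pos v by simp
  define u where "u = scale (complex_of_real (r / nrm v)) v"
  have u: "u \<in> H" "nrm u = r" using v r pos by (auto simp: u_def H_scale nrm_scale norm_divide)
  have uv: "cmod (ip u v) = r * nrm v"
    using v r pos by (simp add: u_def ip_scale_left ip_self(1) norm_mult norm_divide norm_power power2_eq_square)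
  have "2 * cmod (ip u v) \<le> cmod (ip (x + u) v) + cmod (ip (x - u) v)"
  proof -
    have "2 * cmod (ip u v) = cmod (ip (x + u) v - ip (x - u) v)"
      using x u v by (simp add: ip_add_left ip_diff_left norm_mult)
    then show ?thesis by (metis norm_triangle_ineq4)
  qed
  then consider "r * nrm v \<le> cmod (ip (x + u) v)" | "r * nrm v \<le> cmod (ip (x - u) v)"
    using uv by linarith
  then show ?thesis
  proof cases
    case 1
    then show ?thesis using u x by (intro bexI[of _ "x + u"]) (auto simp: H_add)
  next
    case 2
    moreover have "nrm (x - u - x) = r"
      using nrm_minus_commute[of "x - u" x] u x H_diff by simp
    ultimately show ?thesis using u x by (intro bexI[of _ "x - u"]) (auto simp: H_diff)
  qed
qed (use x r in \<open>auto intro!: bexI[of _ x]\<close>)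

text \<open>
  A gliding hump argument without Baire's theorem. If the norms are unbounded, choose \<open>v\<^sub>n\<close> among the vectors with
  \<open>\<parallel>v\<^sub>n\<parallel> > 4\<^sup>n\<close> and move from \<open>x\<^sub>n\<close> by at most \<open>3\<^sup>-\<^sup>n\<close> to \<open>x\<^sub>n\<^sub>+\<^sub>1\<close> with
  \<open>\<bar>ip x\<^sub>n\<^sub>+\<^sub>1 v\<^sub>n\<bar> \<ge> 3\<^sup>-\<^sup>n \<parallel>v\<^sub>n\<parallel>\<close>. All later steps together have length at most
  \<open>3\<^sup>-\<^sup>n / 2\<close>, so they cannot undo more than half of this, and the limit has inner products of size at least
  \<open>(4/3)\<^sup>n / 2\<close> with the \<open>v\<^sub>n\<close>.
\<close>

lemma uniform_boundedness:
  assumes g: "\<And>n::nat. g n \<in> H" and bdd: "\<And>f. f \<in> H \<Longrightarrow> \<exists>C. \<forall>n. cmod (ip f (g n)) \<le> C"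
  shows "\<exists>C. \<forall>n. nrm (g n) \<le> C"
proof (rule ccontr)
  assume "\<nexists>C. \<forall>n. nrm (g n) \<le> C"
  then have "\<exists>k. 4 ^ n < nrm (g k)" for n :: nat
    by (metis not_less)
  then obtain k where k: "\<And>n. 4 ^ n < nrm (g (k n))" by metis
  define v where "v n = g (k n)" for n
  have v: "v n \<in> H" for n by (simp add: v_def g)
  have "\<exists>x. \<forall>n. x n \<in> H \<and> (nrm (x (Suc n) - x n) \<le> (1/3) ^ n \<and>
      (1/3) ^ n * nrm (v n) \<le> cmod (ip (x (Suc n)) (v n)))"
  proof (rule dependent_nat_choice)
    show "\<exists>x. x \<in> H" using H_zero by blast
    fix x n assume "x \<in> H"
    then show "\<exists>y. y \<in> H \<and> (nrm (y - x) \<le> (1/3) ^ n \<and> (1/3) ^ n * nrm (v n) \<le> cmod (ip y (v n)))"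
      using exists_near_large_ip[of x "v n" "(1/3) ^ n"] v by auto
  qed
  then obtain x where x: "\<And>n. x n \<in> H" and step: "\<And>n. nrm (x (Suc n) - x n) \<le> (1/3) ^ n"
    and large: "\<And>n. (1/3) ^ n * nrm (v n) \<le> cmod (ip (x (Suc n)) (v n))"
    by blast
  have tail: "nrm (x (n + m) - x n) \<le> 3/2 * (1/3) ^ n" for n m
  proof -
    have "nrm (x (n + m) - x n) \<le> 3/2 * (1/3) ^ n - 3/2 * (1/3) ^ (n + m)"
    proof (induction m)
      case (Suc m)
      have "nrm (x (n + Suc m) - x n) \<le> nrm (x (Suc (n + m)) - x (n + m)) + nrm (x (n + m) - x n)"
        using nrm_triangle_diff[of "x (Suc (n + m))" "x (n + m)" "x n"] x by simp
      also have "\<dots> \<le> (1/3) ^ (n + m) + (3/2 * (1/3) ^ n - 3/2 * (1/3) ^ (n + m))"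
        using step Suc by (intro add_mono)
      finally show ?case by simp
    qed simp
    moreover have "0 \<le> 3/2 * (1/3 :: real) ^ (n + m)" by simp
    ultimately show ?thesis by linarith
  qed
  have cauchy: "\<exists>N. \<forall>m\<ge>N. \<forall>n\<ge>N. nrm (x m - x n) < e" if "e > 0" for e
  proof -
    obtain N where N: "(1/3 :: real) ^ N < e / 3"
      using real_arch_pow_inv[of "e / 3" "1/3"] \<open>e > 0\<close> by auto
    have near: "nrm (x m - x N) \<le> 3/2 * (1/3) ^ N" if "N \<le> m" for m
      using tail[of N "m - N"] that by simp
    show ?thesis
    proof (intro exI[of _ N] allI impI)
      fix m n assume "N \<le> m" "N \<le> n"
      then have "nrm (x m - x n) \<le> 3/2 * (1/3) ^ N + 3/2 * (1/3) ^ N"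
        using nrm_triangle_diff[of "x m" "x N" "x n"] nrm_minus_commute[of "x N" "x n"] x
          near[of m] near[of n] by simp
      then show "nrm (x m - x n) < e" using N by simp
    qed
  qed
  obtain f where f: "f \<in> H" "(\<lambda>n. nrm (x n - f)) \<longlonglongrightarrow> 0"
    using complete[of x, OF x cauchy] by blast
  have close: "nrm (f - x n) \<le> 3/2 * (1/3) ^ n" for n
  proof (rule tendsto_nrm_diff[OF x f x])
    show "\<forall>\<^sub>F m in sequentially. nrm (x m - x n) \<le> 3/2 * (1/3) ^ n"
      unfolding eventually_sequentially
    proof (intro exI[of _ n] allI impI)
      fix m assume "n \<le> m"
      then show "nrm (x m - x n) \<le> 3/2 * (1/3) ^ n" using tail[of n "m - n"] by simp
    qed
  qed
  have growth: "(4/3) ^ n / 2 \<le> cmod (ip f (v n))" for n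
  proof -
    have "cmod (ip (f - x (Suc n)) (v n)) \<le> 3/2 * (1/3) ^ Suc n * nrm (v n)"
      using Cauchy_Schwarz[of "f - x (Suc n)" "v n"] close[of "Suc n"] f x v H_diff nrm_nonneg[OF v, of n]
      by (meson mult_right_mono order_trans)
    moreover have "cmod (ip (x (Suc n)) (v n)) - cmod (ip (f - x (Suc n)) (v n)) \<le> cmod (ip f (v n))"
      using norm_triangle_ineq2[of "ip (x (Suc n)) (v n)" "ip (x (Suc n)) (v n) - ip f (v n)"] f x v
      by (simp add: ip_diff_left norm_minus_commute)
    ultimately have "(1/3) ^ n * nrm (v n) / 2 \<le> cmod (ip f (v n))"
      using large[of n] by simp
    moreover have "(1/3) ^ n * 4 ^ n \<le> (1/3) ^ n * nrm (v n)"
      using k[of n] by (simp add: v_def)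
    ultimately show ?thesis by (simp add: power_divide)
  qed
  obtain C where C: "\<And>n. cmod (ip f (g n)) \<le> C" using bdd[OF f(1)] by blast
  obtain n where "2 * C < (4/3) ^ n" using real_arch_pow[of "4/3" "2 * C"] by auto
  then show False using growth[of n] C[of "k n"] by (simp add: v_def)
qed

text \<open>
  The limit functional is linear, and bounded because the \<open>g\<^sub>n\<close> are bounded by the uniform boundedness principle.
\<close>

lemma weak_limit_representable:
  assumes g: "\<And>n::nat. g n \<in> H" and lim: "\<And>f. f \<in> H \<Longrightarrow> (\<lambda>n. ip f (g n)) \<longlonglongrightarrow> \<phi> f"
  shows "\<exists>h\<in>H. \<forall>f\<in>H. \<phi> f = ip f h"
proof -
  have "\<exists>C. \<forall>n. cmod (ip f (g n)) \<le> C" if "f \<in> H" for f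
    using convergent_imp_Bseq[of "\<lambda>n. ip f (g n)"] lim[OF that]
    by (auto simp: convergent_def Bseq_def)
  from uniform_boundedness[OF g this] obtain C where C: "\<And>n. nrm (g n) \<le> C" by blast
  show ?thesis
  proof (rule riesz_representation)
    fix f f' assume f: "f \<in> H" "f' \<in> H"
    have "(\<lambda>n. ip (f + f') (g n)) \<longlonglongrightarrow> \<phi> f + \<phi> f'"
      using tendsto_add[OF lim[OF f(1)] lim[OF f(2)]] f g by (simp add: ip_add_left)
    then show "\<phi> (f + f') = \<phi> f + \<phi> f'"
      using lim[of "f + f'"] f H_add LIMSEQ_unique by blast
  next
    fix c f assume f: "f \<in> H"
    have "(\<lambda>n. ip (scale c f) (g n)) \<longlonglongrightarrow> c * \<phi> f"
      using tendsto_mult_left[OF lim[OF f], of c] f g by (simp add: ip_scale_left)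
    then show "\<phi> (scale c f) = c * \<phi> f"
      using lim[of "scale c f"] f H_scale LIMSEQ_unique by blast
  next
    fix f assume f: "f \<in> H"
    have "cmod (ip f (g n)) \<le> C * nrm f" for n
      using Cauchy_Schwarz[OF f g, of n] mult_left_mono[OF C nrm_nonneg[OF f], of n]
      by (simp add: mult.commute)
    then show "cmod (\<phi> f) \<le> C * nrm f"
      by (intro LIMSEQ_le_const2[OF tendsto_norm[OF lim[OF f]]]) auto
  qed
qed

text \<open>
  The functional \<open>f \<mapsto> ip f h\<close> is continuous.
\<close>

lemma ip_eq_zero_of_dense:
  assumes D: "D \<subseteq> H" and dense: "\<And>f e. f \<in> H \<Longrightarrow> e > 0 \<Longrightarrow> \<exists>p\<in>D. nrm (f - p) < e"
    and h: "h \<in> H" and zero: "\<And>p. p \<in> D \<Longrightarrow> ip p h = 0" and f: "f \<in> H"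
  shows "ip f h = 0"
proof (rule ccontr)
  assume ne: "ip f h \<noteq> 0"
  \<comment> \<open>The summand \<open>1\<close> avoids a separate case for \<open>h = 0\<close>.\<close>
  define e where "e = cmod (ip f h) / (nrm h + 1)"
  have pos: "0 < nrm h + 1" using nrm_nonneg[OF h] by simp
  then have "0 < e" using ne by (simp add: e_def)
  then obtain p where p: "p \<in> D" "nrm (f - p) < e" using dense[OF f] by blast
  then have pH: "p \<in> H" using D by blast
  have "cmod (ip f h) = cmod (ip (f - p) h)" using f h pH zero[OF p(1)] by (simp add: ip_diff_left)
  also have "\<dots> \<le> nrm (f - p) * nrm h" using Cauchy_Schwarz f pH h H_diff by simp
  also have "\<dots> \<le> e * nrm h" using p(2) nrm_nonneg[OF h] by (simp add: mult_right_mono)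
  also have "\<dots> < e * (nrm h + 1)" using \<open>0 < e\<close> by simp
  also have "\<dots> = cmod (ip f h)" using pos by (simp add: e_def)
  finally show False by simp
qed

lemma ip_separates:
  assumes "h \<in> H" "\<And>f. f \<in> H \<Longrightarrow> ip f h = 0"
  shows "h = 0"
  using ip_pos[OF assms(1)] assms(2)[OF assms(1)] by force

text \<open>
  Riesz's theorem provides the value \<open>h\<close> of the adjoint, which is unique; and \<open>h = 0\<close> iff \<open>h\<close> is orthogonal to
  the dense set \<open>D\<close>.
\<close>

lemma hadjoint_eq_zero_iff:
  assumes T: "\<And>f. f \<in> H \<Longrightarrow> T f \<in> H"
    and add: "\<And>f g. f \<in> H \<Longrightarrow> g \<in> H \<Longrightarrow> T (f + g) = T f + T g"
    and scale: "\<And>c f. f \<in> H \<Longrightarrow> T (scale c f) = scale c (T f)"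
    and bound: "\<And>f. f \<in> H \<Longrightarrow> nrm (T f) \<le> C * nrm f"
    and D: "D \<subseteq> H" and dense: "\<And>f e. f \<in> H \<Longrightarrow> e > 0 \<Longrightarrow> \<exists>p\<in>D. nrm (f - p) < e"
    and g: "g \<in> H"
  shows "hadjoint H ip T g = 0 \<longleftrightarrow> (\<forall>p\<in>D. ip (T p) g = 0)"
proof -
  have "\<exists>h\<in>H. \<forall>f\<in>H. ip (T f) g = ip f h"
  proof (rule riesz_representation)
    fix f assume f: "f \<in> H"
    have "cmod (ip (T f) g) \<le> nrm (T f) * nrm g" using Cauchy_Schwarz T f g by simp
    also have "\<dots> \<le> (C * nrm f) * nrm g" using bound f nrm_nonneg g by (simp add: mult_right_mono)
    finally show "cmod (ip (T f) g) \<le> (C * nrm g) * nrm f" by (simp add: mult_ac)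
  qed (use T add scale g in \<open>auto simp: ip_add_left ip_scale_left\<close>)
  then obtain h where h: "h \<in> H" "\<And>f. f \<in> H \<Longrightarrow> ip (T f) g = ip f h" by blast
  have "hadjoint H ip T g = h"
    unfolding hadjoint_def
  proof (rule the_equality)
    fix h' assume h': "h' \<in> H \<and> (\<forall>f\<in>H. ip (T f) g = ip f h')"
    then have "h' - h = 0"
      using h by (intro ip_separates) (auto simp: H_diff ip_diff_right)
    then show "h' = h" by simp
  qed (use h in blast)
  moreover have "h = 0 \<longleftrightarrow> (\<forall>p\<in>D. ip p h = 0)"
    using ip_separates[OF h(1)] ip_eq_zero_of_dense[OF D dense h(1)] D by auto
  moreover have "ip (T p) g = ip p h" if "p \<in> D" for p using that h(2) D by blast
  ultimately show ?thesis by simp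
qed

lemma sum_scale_mem: "(\<And>a. a \<in> A \<Longrightarrow> v a \<in> H) \<Longrightarrow> (\<Sum>a\<in>A. scale (c a) (v a)) \<in> H"
  by (intro subspace_sum[OF subspace_H] H_scale)

lemma ip_sum_scale_right:
  assumes "f \<in> H" "\<And>a. a \<in> A \<Longrightarrow> v a \<in> H"
  shows "ip f (\<Sum>a\<in>A. scale (c a) (v a)) = (\<Sum>a\<in>A. cnj (c a) * ip f (v a))"
  using assms
  by (induction A rule: infinite_finite_induct)
     (simp_all add: ip_add_right ip_scale_right H_scale sum_scale_mem)

end


section \<open>Iterated partial derivatives of holomorphic functions\<close>

lemma axis_zero [simp]: "axis i (0::complex) = 0"
  by (simp add: vec_eq_iff axis_def)

lemma axis_add: "axis i (a + b) = axis i a + (axis i b :: complex^'m)"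
  by (simp add: vec_eq_iff axis_def)

lemma axis_conv_scale: "axis i (c::complex) = c *s axis i 1"
  by (simp add: vec_eq_iff axis_def)

lemma norm_axis [simp]: "norm (axis i c :: complex^'m) = cmod c"
proof -
  have "(\<Sum>j\<in>UNIV. (cmod (axis i c $ j))\<^sup>2) = (\<Sum>j\<in>UNIV. if j = i then (cmod c)\<^sup>2 else 0)"
    by (intro sum.cong) (auto simp: axis_def)
  then show ?thesis by (simp add: norm_vec_def L2_set_def)
qed

lemma bounded_linear_axis: "bounded_linear (axis i :: complex \<Rightarrow> complex^'m)"
proof (rule bounded_linear_intro[of _ 1])
  show "axis i (r *\<^sub>R c) = r *\<^sub>R (axis i c :: complex^'m)" for r c
    by (simp add: vec_eq_iff axis_def)
qed (auto simp: axis_add)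

lemmas continuous_on_axis [continuous_intros] = bounded_linear.continuous_on[OF bounded_linear_axis]

definition partial_deriv :: "'m \<Rightarrow> (complex^'m \<Rightarrow> complex) \<Rightarrow> complex^'m \<Rightarrow> complex" where
  "partial_deriv i f z = deriv (\<lambda>c. f (z + axis i c)) 0"

text \<open>
  The regularity that iterated differentiation preserves by one-variable arguments alone: continuity in all variables
  jointly, which gives local bounds, and holomorphy in each variable separately.
\<close>

definition sep_holomorphic :: "(complex^'m) set \<Rightarrow> (complex^'m \<Rightarrow> complex) \<Rightarrow> bool" where
  "sep_holomorphic \<Omega> f \<longleftrightarrow> continuous_on \<Omega> f \<and>
     (\<forall>z\<in>\<Omega>. \<forall>i. (\<lambda>c. f (z + axis i c)) field_differentiable at 0)"

lemma sep_holomorphic_has_field_derivative: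
  assumes "sep_holomorphic \<Omega> f" "z \<in> \<Omega>"
  shows "((\<lambda>c. f (z + axis i c)) has_field_derivative partial_deriv i f z) (at 0)"
  using assms by (simp add: sep_holomorphic_def partial_deriv_def field_differentiable_derivI)

lemma holomorphic_several_imp_sep:
  fixes f :: "complex^'m \<Rightarrow> complex"
  assumes f: "holomorphic_several f \<Omega>"
  shows "sep_holomorphic \<Omega> f"
  unfolding sep_holomorphic_def
proof (intro conjI ballI allI)
  show "continuous_on \<Omega> f"
    using f unfolding holomorphic_several_def continuous_on_eq_continuous_within
    by (metis has_derivative_continuous continuous_at_imp_continuous_at_within)
next
  fix z i assume "z \<in> \<Omega>"
  then obtain f' where f': "(f has_derivative f') (at z)" "\<And>c v. f' (c *s v) = c * f' v"
    using f unfolding holomorphic_several_def by blast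
  have "((\<lambda>c. z + axis i c) has_derivative (\<lambda>c. axis i c)) (at 0)"
    using has_derivative_add[OF has_derivative_const[of z]
        bounded_linear.has_derivative[OF bounded_linear_axis has_derivative_ident]] by simp
  then have "((\<lambda>c. f (z + axis i c)) has_derivative (\<lambda>c. f' (axis i c))) (at 0)"
    by (rule has_derivative_compose) (use f'(1) in simp)
  moreover have "(\<lambda>c. f' (axis i c)) = (*) (f' (axis i 1))"
  proof
    fix c
    show "f' (axis i c) = f' (axis i 1) * c"
      using f'(2)[of c "axis i 1"] by (simp only: axis_conv_scale[of i c] mult.commute)
  qed
  ultimately show "(\<lambda>c. f (z + axis i c)) field_differentiable at 0"
    by (auto simp: field_differentiable_def has_field_derivative_def)
qed

lemma open_slice:
  assumes "open (\<Omega> :: (complex^'m) set)"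
  shows "open {c. z + axis i c \<in> \<Omega>}"
proof -
  have "open ((\<lambda>c. z + axis i c) -` \<Omega>)"
    by (intro open_vimage assms continuous_intros)
  then show ?thesis by (simp add: vimage_def)
qed

lemma sep_holomorphic_slice:
  assumes f: "sep_holomorphic \<Omega> f"
  shows "(\<lambda>c. f (z + axis i c)) holomorphic_on {c. z + axis i c \<in> \<Omega>}"
proof (rule holomorphic_onI)
  fix c assume c: "c \<in> {c. z + axis i c \<in> \<Omega>}"
  then have "((\<lambda>h. f ((z + axis i c) + axis i h)) has_field_derivative partial_deriv i f (z + axis i c)) (at 0)"
    by (intro sep_holomorphic_has_field_derivative[OF f]) simp
  then have "((\<lambda>h. f (z + axis i h)) has_field_derivative partial_deriv i f (z + axis i c)) (at c)"
    using DERIV_shift[of "\<lambda>h. f (z + axis i h)" _ 0 c] by (simp add: axis_add add_ac)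
  then show "(\<lambda>c. f (z + axis i c)) field_differentiable at c within {c. z + axis i c \<in> \<Omega>}"
    using field_differentiable_at_within field_differentiable_def by blast
qed

text \<open>
  Second-order Taylor expansion. On \<open>ball 0 r\<close> Cauchy's estimate on discs of radius \<open>r/2\<close> bounds
  \<open>\<phi>''\<close> by \<open>2 B / (r/2)\<^sup>2\<close>. The bound depends on \<open>\<phi>\<close> only through \<open>B\<close> and \<open>r\<close>, which makes the convergence of
  difference quotients uniform in the remaining variables.
\<close>

lemma difference_quotient_error:
  assumes hol: "\<phi> holomorphic_on ball 0 (2 * r)" and B: "\<And>c. c \<in> ball 0 (2 * r) \<Longrightarrow> cmod (\<phi> c) < B"
    and r: "0 < r" and h: "cmod h < r" "h \<noteq> 0"
  shows "cmod ((\<phi> h - \<phi> 0) / h - deriv \<phi> 0) \<le> 8 * B / r\<^sup>2 * cmod h"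
proof -
  have bound: "cmod ((deriv ^^ 2) \<phi> x) \<le> 8 * B / r\<^sup>2" if x: "x \<in> ball 0 r" for x
  proof -
    have sub: "cball x (r / 2) \<subseteq> ball 0 (2 * r)"
    proof
      fix y assume "y \<in> cball x (r / 2)"
      then show "y \<in> ball 0 (2 * r)" using x r norm_triangle_sub[of y x] by (simp add: dist_norm norm_minus_commute)
    qed
    have "cmod ((deriv ^^ 2) \<phi> x) \<le> fact 2 * B / (r / 2) ^ 2"
    proof (rule Cauchy_higher_deriv_bound[where y = 0])
      show "\<phi> holomorphic_on ball x (r / 2)"
        using hol sub by (meson ball_subset_cball holomorphic_on_subset order_trans)
      show "continuous_on (cball x (r / 2)) \<phi>"
        using holomorphic_on_imp_continuous_on[OF hol] sub continuous_on_subset by blast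
      show "\<phi> w \<in> ball 0 B" if "w \<in> ball x (r / 2)" for w
      proof -
        have "w \<in> ball 0 (2 * r)" using that sub by (meson ball_subset_cball subsetD)
        from B[OF this] show ?thesis by simp
      qed
    qed (use r in auto)
    then show ?thesis by (simp add: power_divide)
  qed
  have "cmod (((deriv ^^ 0) \<phi>) h - (\<Sum>i\<le>1. (deriv ^^ i) \<phi> 0 * (h - 0) ^ i / fact i))
      \<le> 8 * B / r\<^sup>2 * cmod (h - 0) ^ Suc 1 / fact 1"
  proof (rule complex_Taylor[where S = "ball 0 r" and f = "\<lambda>i. (deriv ^^ i) \<phi>"])
    fix i :: nat and x :: complex assume x: "x \<in> ball 0 r" "i \<le> 1"
    have "(deriv ^^ i) \<phi> holomorphic_on ball 0 (2 * r)"
      by (intro holomorphic_higher_deriv hol) auto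
    then have "((deriv ^^ i) \<phi> has_field_derivative deriv ((deriv ^^ i) \<phi>) x) (at x)"
      by (rule holomorphic_derivI) (use x r in auto)
    then show "((deriv ^^ i) \<phi> has_field_derivative (deriv ^^ Suc i) \<phi> x) (at x within ball 0 r)"
      by (simp add: has_field_derivative_at_within)
  qed (use bound r h in \<open>auto simp: numeral_2_eq_2\<close>)
  then have "cmod (\<phi> h - \<phi> 0 - deriv \<phi> 0 * h) \<le> 8 * B / r\<^sup>2 * cmod h * cmod h"
    by (simp add: One_nat_def algebra_simps power2_eq_square)
  then have "cmod (\<phi> h - \<phi> 0 - deriv \<phi> 0 * h) / cmod h \<le> 8 * B / r\<^sup>2 * cmod h"
    using h by (simp add: divide_le_eq)
  moreover have "(\<phi> h - \<phi> 0) / h - deriv \<phi> 0 = (\<phi> h - \<phi> 0 - deriv \<phi> 0 * h) / h"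
    using h by (simp add: field_simps)
  ultimately show ?thesis by (simp add: norm_divide)
qed

text \<open>
  Near each point the difference quotients converge uniformly to the partial derivative, so it inherits continuity and,
  by Weierstrass' theorem applied in each variable, separate holomorphy.
\<close>

lemma sep_holomorphic_partial_deriv:
  fixes f :: "complex^'m \<Rightarrow> complex"
  assumes f: "sep_holomorphic \<Omega> f" and \<Omega>: "open \<Omega>"
  shows "sep_holomorphic \<Omega> (partial_deriv i f)"
proof -
  have key: "continuous_on (ball z0 r) (partial_deriv i f) \<and>
      (\<forall>j. (\<lambda>c. partial_deriv i f (z0 + axis j c)) holomorphic_on ball 0 r)"
    if z0: "cball z0 (3 * r) \<subseteq> \<Omega>" and r: "0 < r" for z0 r
  proof -
    have contf: "continuous_on \<Omega> f" using f by (simp add: sep_holomorphic_def)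
    have "compact (f ` cball z0 (3 * r))"
      by (intro compact_continuous_image continuous_on_subset[OF contf z0] compact_cball)
    then have "bounded (f ` cball z0 (3 * r))" by (rule compact_imp_bounded)
    then obtain B where B: "\<And>z. z \<in> cball z0 (3 * r) \<Longrightarrow> cmod (f z) < B"
      unfolding bounded_pos_less by blast
    have inside: "z + axis j c \<in> cball z0 (3 * r)" if "z \<in> ball z0 r" "cmod c < 2 * r" for z c j
      using that dist_triangle[of z0 "z + axis j c" z] by (simp add: dist_norm)
    \<comment> \<open>Increments of modulus less than \<open>r\<close>, so that all points involved stay in \<open>\<Omega>\<close>.\<close>
    define h where "h n = complex_of_real (r / Suc (Suc n))" for n
    have h: "cmod (h n) < r" "h n \<noteq> 0" for n
      using r by (auto simp: h_def norm_divide field_simps simp del: of_nat_Suc)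
    have h_lim: "h \<longlonglongrightarrow> 0"
      unfolding h_def
      using tendsto_of_real[OF LIMSEQ_Suc[OF LIMSEQ_Suc[OF lim_const_over_n[of r]]], where 'a = complex]
      by (simp only: of_real_0)
    define Q where "Q n z = (f (z + axis i (h n)) - f z) / h n" for n z
    have err: "cmod (Q n z - partial_deriv i f z) \<le> 8 * B / r\<^sup>2 * cmod (h n)" if z: "z \<in> ball z0 r" for n z
    proof -
      have "(\<lambda>c. f (z + axis i c)) holomorphic_on ball 0 (2 * r)"
        by (rule holomorphic_on_subset[OF sep_holomorphic_slice[OF f]])
           (use inside[OF z] z0 in auto)
      from difference_quotient_error[OF this _ r h] show ?thesis
        using B inside[OF z] by (simp add: Q_def partial_deriv_def)
    qed
    have unif: "uniform_limit (ball z0 r) Q (partial_deriv i f) sequentially"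
    proof (rule uniform_limitI)
      fix e :: real assume e: "0 < e"
      have "(\<lambda>n. 8 * B / r\<^sup>2 * cmod (h n)) \<longlonglongrightarrow> 8 * B / r\<^sup>2 * cmod 0"
        by (intro tendsto_intros h_lim)
      then have "\<forall>\<^sub>F n in sequentially. 8 * B / r\<^sup>2 * cmod (h n) < e"
        using e by (intro order_tendstoD(2)) auto
      then show "\<forall>\<^sub>F n in sequentially. \<forall>x\<in>ball z0 r. dist (Q n x) (partial_deriv i f x) < e"
      proof eventually_elim
        case (elim n)
        show ?case
        proof
          fix x assume "x \<in> ball z0 r"
          from err[OF this, of n] elim show "dist (Q n x) (partial_deriv i f x) < e"
            by (simp add: dist_norm)
        qed
      qed
    qed
    have contQ: "continuous_on (ball z0 r) (Q n)" for n
    proof -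
      have "continuous_on (ball z0 r) (\<lambda>z. f (z + axis i (h n)))"
      proof (rule continuous_on_compose2[OF contf])
        show "continuous_on (ball z0 r) (\<lambda>z. z + axis i (h n))" by (intro continuous_intros)
        show "(\<lambda>z. z + axis i (h n)) ` ball z0 r \<subseteq> \<Omega>"
          using inside[of _ "h n" i] h[of n] r z0 by auto
      qed
      moreover have "continuous_on (ball z0 r) f"
        by (rule continuous_on_subset[OF contf]) (use z0 r in force)
      ultimately show ?thesis unfolding Q_def by (intro continuous_intros) (use h in auto)
    qed
    have holQ: "(\<lambda>c. Q n (z0 + axis j c)) holomorphic_on ball 0 r" for n j
    proof -
      have "(\<lambda>c. f ((z0 + axis i (h n)) + axis j c)) holomorphic_on ball 0 r"
      proof (rule holomorphic_on_subset[OF sep_holomorphic_slice[OF f]])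
        have "z0 + axis i (h n) + axis j c \<in> \<Omega>" if "c \<in> ball 0 r" for c
          using inside[of "z0 + axis j c" "h n" i] that h[of n] z0 r
          by (auto simp: dist_norm add.assoc add.commute[of "axis i (h n)"])
        then show "ball 0 r \<subseteq> {c. z0 + axis i (h n) + axis j c \<in> \<Omega>}" by blast
      qed
      moreover have "(\<lambda>c. f (z0 + axis j c)) holomorphic_on ball 0 r"
        by (rule holomorphic_on_subset[OF sep_holomorphic_slice[OF f]])
           (use inside[of z0] z0 r in auto)
      ultimately show ?thesis
        unfolding Q_def using h by (auto intro!: holomorphic_intros simp: add_ac)
    qed
    have "(\<lambda>c. partial_deriv i f (z0 + axis j c)) holomorphic_on ball 0 r" for j
    proof (rule holomorphic_uniform_sequence[OF open_ball holQ])
      fix x :: complex assume x: "x \<in> ball 0 r"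
      obtain d where d: "0 < d" "cball x d \<subseteq> ball 0 r"
        using x open_contains_cball[of "ball 0 r :: complex set"] by (metis open_ball)
      moreover have "uniform_limit (cball x d) (\<lambda>n c. Q n (z0 + axis j c))
          (\<lambda>c. partial_deriv i f (z0 + axis j c)) sequentially"
        by (rule uniform_limit_compose'[OF unif]) (use d in \<open>force simp: dist_norm\<close>)
      ultimately show "\<exists>d>0. cball x d \<subseteq> ball 0 r \<and> uniform_limit (cball x d) (\<lambda>n c. Q n (z0 + axis j c))
          (\<lambda>c. partial_deriv i f (z0 + axis j c)) sequentially" by blast
    qed
    moreover have "continuous_on (ball z0 r) (partial_deriv i f)"
      by (rule uniform_limit_theorem[OF _ unif]) (use contQ in auto)
    ultimately show ?thesis by blast
  qed
  have local: "\<exists>r>0. cball z (3 * r) \<subseteq> \<Omega>" if "z \<in> \<Omega>" for z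
  proof -
    obtain e where "e > 0" "cball z e \<subseteq> \<Omega>" using \<Omega> \<open>z \<in> \<Omega>\<close> open_contains_cball by blast
    then show ?thesis by (intro exI[of _ "e / 3"]) auto
  qed
  show ?thesis
    unfolding sep_holomorphic_def
  proof (intro conjI ballI allI)
    have "continuous (at z) (partial_deriv i f)" if "z \<in> \<Omega>" for z
      using local[OF that] key[of z] continuous_on_eq_continuous_at[OF open_ball, of z _ "partial_deriv i f"]
      by (metis centre_in_ball)
    then show "continuous_on \<Omega> (partial_deriv i f)"
      using continuous_at_imp_continuous_on by blast
  next
    fix z j assume "z \<in> \<Omega>"
    then obtain r where "r > 0" "(\<lambda>c. partial_deriv i f (z + axis j c)) holomorphic_on ball 0 r"
      using local key by blast
    then show "(\<lambda>c. partial_deriv i f (z + axis j c)) field_differentiable at 0"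
      by (intro holomorphic_on_imp_differentiable_at[OF _ open_ball]) auto
  qed
qed

lemma partial_deriv_limit:
  assumes "sep_holomorphic \<Omega> f" "z \<in> \<Omega>" "h \<longlonglongrightarrow> 0" "\<And>n. h n \<noteq> 0"
  shows "(\<lambda>n. (f (z + axis i (h n)) - f z) / h n) \<longlonglongrightarrow> partial_deriv i f z"
proof -
  have "((\<lambda>c. (f (z + axis i c) - f z) / c) \<longlongrightarrow> partial_deriv i f z) (at 0)"
    using sep_holomorphic_has_field_derivative[OF assms(1,2), of i]
    by (simp add: has_field_derivative_iff)
  then show ?thesis
    by (rule filterlim_compose) (use assms(3,4) in \<open>auto simp: filterlim_at\<close>)
qed

text \<open>
  The conjugate of a holomorphic function is antiholomorphic: along \<open>u s\<close> with \<open>s\<close> real it has derivative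
  \<open>cnj (u a)\<close>, where \<open>a\<close> is the complex derivative. For \<open>u = 1\<close> and \<open>u = \<i>\<close> both terms of
  \<^const>\<open>dbar\<close> equal \<open>cnj a\<close>. Only the values of \<open>F\<close> on \<open>\<Omega>\<close> matter.
\<close>

lemma dbar_cnj:
  assumes f: "sep_holomorphic \<Omega> f" and \<Omega>: "open \<Omega>" and z: "z \<in> \<Omega>"
    and F: "\<And>w. w \<in> \<Omega> \<Longrightarrow> F w = cnj (f w)"
  shows "dbar i F z = cnj (partial_deriv i f z)"
proof -
  have "vector_derivative (\<lambda>s::real. F (z + axis i (u * of_real s))) (at 0) = cnj (u * partial_deriv i f z)"
    for u :: complex
  proof (rule vector_derivative_at)
    have "((\<lambda>s::real. u * of_real s) has_vector_derivative u) (at 0)"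
      by (auto intro!: derivative_eq_intros simp: has_vector_derivative_def scaleR_conv_of_real mult.commute)
    then have "((\<lambda>c. f (z + axis i c)) \<circ> (\<lambda>s::real. u * of_real s) has_vector_derivative u * partial_deriv i f z) (at 0)"
      by (rule field_vector_diff_chain_at)
         (use sep_holomorphic_has_field_derivative[OF f z] in simp)
    then have "((\<lambda>s::real. cnj (f (z + axis i (u * of_real s)))) has_vector_derivative cnj (u * partial_deriv i f z)) (at 0)"
      unfolding comp_def by (rule bounded_linear.has_vector_derivative[OF bounded_linear_cnj])
    moreover have "open ((\<lambda>s::real. z + axis i (u * of_real s)) -` \<Omega>)"
      by (intro open_vimage \<Omega> continuous_intros)
    ultimately show "((\<lambda>s::real. F (z + axis i (u * of_real s))) has_vector_derivative cnj (u * partial_deriv i f z)) (at 0)"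
      by (rule has_vector_derivative_transform_within_open)
         (use z F in auto)
  qed
  from this[of 1] this[of \<i>] show ?thesis by (simp add: dbar_def)
qed

lemma multi_deriv_dbar_cnj:
  assumes f: "sep_holomorphic \<Omega> f" and \<Omega>: "open \<Omega>" and z: "z \<in> \<Omega>"
    and F: "\<And>w. w \<in> \<Omega> \<Longrightarrow> F w = cnj (f w)"
  shows "multi_deriv dbar \<alpha> F z = cnj (multi_deriv partial_deriv \<alpha> f z)"
proof -
  have "sep_holomorphic \<Omega> (multi_deriv partial_deriv \<alpha> f) \<and>
      (\<forall>z\<in>\<Omega>. multi_deriv dbar \<alpha> F z = cnj (multi_deriv partial_deriv \<alpha> f z))"
    by (rule multi_deriv_rel[of "\<lambda>A B. sep_holomorphic \<Omega> (B f) \<and> (\<forall>z\<in>\<Omega>. A F z = cnj (B f z))"])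
       (use f F \<Omega> in \<open>auto simp: sep_holomorphic_partial_deriv dbar_cnj\<close>)
  then show ?thesis using z by blast
qed

lemma mp_eval_has_field_derivative:
  "((\<lambda>c. mp_eval p (z + axis i c)) has_field_derivative mp_eval (mp_diff i p) z) (at 0)"
proof (induction p rule: mpol_induct)
  case (single \<alpha> a)
  show ?case
  proof (induction \<alpha> rule: exponent_induct)
    case zero
    show ?case by (simp add: mp_diff_single mp_eval_single)
  next
    case (step j \<alpha>)
    let ?p = "Poly_Mapping.single \<alpha> a" and ?v = "Poly_Mapping.single (Poly_Mapping.single j 1) (1::complex)"
    have v: "((\<lambda>c. mp_eval ?v (z + axis i c)) has_field_derivative (if i = j then 1 else 0)) (at 0)"
      by (auto simp: mp_eval_single axis_def intro!: derivative_eq_intros)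
    have "((\<lambda>c. mp_eval ?v (z + axis i c) * mp_eval ?p (z + axis i c)) has_field_derivative
        mp_eval (mp_diff i (?v * ?p)) z) (at 0)"
      unfolding mp_diff_var_mult mp_eval_add mp_eval_mult
      by (rule DERIV_cong[OF DERIV_mult[OF v step]]) auto
    then show ?case by (simp add: mult_single flip: mp_eval_mult)
  qed
next
  case (add p q)
  then show ?case by (simp add: mp_eval_add mp_diff_add DERIV_add)
qed

lemma multi_deriv_mp_fun:
  assumes \<Omega>: "open \<Omega>" and z: "z \<in> \<Omega>"
  shows "multi_deriv partial_deriv \<alpha> (mp_fun \<Omega> p) z = mp_eval (multi_deriv mp_diff \<alpha> p) z"
proof -
  have step: "partial_deriv i f z = mp_eval (mp_diff i p) z"
    if f: "\<forall>z\<in>\<Omega>. f z = mp_eval p z" and z: "z \<in> \<Omega>" for f p i z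
  proof -
    have "((\<lambda>c. f (z + axis i c)) has_field_derivative mp_eval (mp_diff i p) z) (at 0)"
      by (rule has_field_derivative_transform_within_open[OF mp_eval_has_field_derivative open_slice[OF \<Omega>, of z i]])
         (use f z in auto)
    then show ?thesis by (simp add: partial_deriv_def DERIV_imp_deriv)
  qed
  have "\<forall>z\<in>\<Omega>. multi_deriv partial_deriv \<alpha> (mp_fun \<Omega> p) z = mp_eval (multi_deriv mp_diff \<alpha> p) z"
    by (rule multi_deriv_rel[of "\<lambda>A B. \<forall>z\<in>\<Omega>. A (mp_fun \<Omega> p) z = mp_eval (B p) z"])
       (use step in \<open>auto simp: mp_fun_def\<close>)
  then show ?thesis using z by blast
qed


section \<open>Kernel derivatives as representing vectors\<close>

lemma vector_space_fun_smult: "vector_space (fun_smult :: complex \<Rightarrow> ('z \<Rightarrow> complex) \<Rightarrow> _)"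
  by unfold_locales (rule ext, simp add: fun_smult_def algebra_simps)+

lemma holomorphic_hilbert_space_hilbert_on:
  assumes "holomorphic_hilbert_space \<Omega> H ip"
  shows "hilbert_on fun_smult H ip"
proof -
  interpret vector_space "fun_smult :: complex \<Rightarrow> (complex^'a \<Rightarrow> complex) \<Rightarrow> _"
    by (rule vector_space_fun_smult)
  show ?thesis
  proof
    show "subspace H"
      using assms by (simp add: holomorphic_hilbert_space_def subspace_def)
    fix s :: "nat \<Rightarrow> complex^'a \<Rightarrow> complex"
    assume "\<And>n. s n \<in> H" "\<And>e. e > 0 \<Longrightarrow> \<exists>N. \<forall>k\<ge>N. \<forall>n\<ge>N. hnorm ip (s k - s n) < e"
    then show "\<exists>f\<in>H. (\<lambda>n. hnorm ip (s n - f)) \<longlonglongrightarrow> 0"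
      using assms unfolding holomorphic_hilbert_space_def by blast
  qed (use assms in \<open>unfold holomorphic_hilbert_space_def, blast+\<close>)
qed

lemma holomorphic_hilbert_space_functions:
  assumes "holomorphic_hilbert_space \<Omega> H ip" "f \<in> H"
  shows "sep_holomorphic \<Omega> f" "z \<notin> \<Omega> \<Longrightarrow> f z = 0"
proof -
  have "\<forall>f\<in>H. holomorphic_several f \<Omega> \<and> (\<forall>z. z \<notin> \<Omega> \<longrightarrow> f z = 0)"
    using assms(1) unfolding holomorphic_hilbert_space_def by (rule conjunct1)
  with assms(2) show "sep_holomorphic \<Omega> f" "z \<notin> \<Omega> \<Longrightarrow> f z = 0"
    by (auto intro: holomorphic_several_imp_sep)
qed

text \<open>
  Induction on the number of derivatives. The difference quotient with increment \<open>h\<close> of a represented family is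
  represented by the conjugate difference quotient of the representing vectors, and weak limits of these exist.
\<close>

lemma derivative_representable:
  fixes \<Omega> :: "(complex^('m::{finite,linorder})) set"
  assumes hol: "holomorphic_hilbert_space \<Omega> H ip" and \<Omega>: "open \<Omega>"
    and K: "reproducing_kernel \<Omega> H ip K" and w: "w \<in> \<Omega>"
  shows "\<exists>g\<in>H. \<forall>f\<in>H. multi_deriv partial_deriv \<alpha> f w = ip f g"
proof -
  interpret hilbert_on fun_smult H ip
    by (rule holomorphic_hilbert_space_hilbert_on[OF hol])
  have "(\<forall>f\<in>H. sep_holomorphic \<Omega> (multi_deriv partial_deriv \<alpha> f)) \<and>
      (\<forall>w\<in>\<Omega>. \<exists>g\<in>H. \<forall>f\<in>H. multi_deriv partial_deriv \<alpha> f w = ip f g)"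
  proof (rule multi_deriv_ind[of "\<lambda>F. (\<forall>f\<in>H. sep_holomorphic \<Omega> (F f)) \<and> (\<forall>w\<in>\<Omega>. \<exists>g\<in>H. \<forall>f\<in>H. F f w = ip f g)"])
    have "\<forall>f\<in>H. sep_holomorphic \<Omega> f"
      using holomorphic_hilbert_space_functions(1)[OF hol] by blast
    moreover have "\<forall>w\<in>\<Omega>. \<exists>g\<in>H. \<forall>f\<in>H. f w = ip f g"
    proof
      fix w assume "w \<in> \<Omega>"
      then show "\<exists>g\<in>H. \<forall>f\<in>H. f w = ip f g"
        using K by (intro bexI[of _ "\<lambda>z. K z w"]) (auto simp: reproducing_kernel_def)
    qed
    ultimately show "(\<forall>f\<in>H. sep_holomorphic \<Omega> (id f)) \<and> (\<forall>w\<in>\<Omega>. \<exists>g\<in>H. \<forall>f\<in>H. id f w = ip f g)"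
      by simp
  next
    fix i and F :: "((complex, 'm) vec \<Rightarrow> complex) \<Rightarrow> (complex, 'm) vec \<Rightarrow> complex"
    assume F: "(\<forall>f\<in>H. sep_holomorphic \<Omega> (F f)) \<and> (\<forall>w\<in>\<Omega>. \<exists>g\<in>H. \<forall>f\<in>H. F f w = ip f g)"
    then obtain g where g: "\<And>w. w \<in> \<Omega> \<Longrightarrow> g w \<in> H" "\<And>w f. w \<in> \<Omega> \<Longrightarrow> f \<in> H \<Longrightarrow> F f w = ip f (g w)"
      by metis
    have "\<exists>k\<in>H. \<forall>f\<in>H. partial_deriv i (F f) w = ip f k" if w: "w \<in> \<Omega>" for w
    proof -
      have "0 \<in> {c. w + axis i c \<in> \<Omega>}" using w by simp
      then obtain e where "0 < e" and ball: "ball 0 e \<subseteq> {c. w + axis i c \<in> \<Omega>}"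
        by (rule openE[OF open_slice[OF \<Omega>]])
      then have e: "w + axis i c \<in> \<Omega>" if "cmod c < e" for c
        using that subsetD[OF ball, of c] by auto
      define h where "h n = complex_of_real (e / Suc (Suc n))" for n
      have h: "h n \<noteq> 0" "w + axis i (h n) \<in> \<Omega>" for n
        using \<open>0 < e\<close>
        by (auto simp: h_def norm_divide field_simps simp del: of_nat_Suc intro!: e)
      have h_lim: "h \<longlonglongrightarrow> 0"
        unfolding h_def
        using tendsto_of_real[OF LIMSEQ_Suc[OF LIMSEQ_Suc[OF lim_const_over_n[of e]]], where 'a = complex]
        by (simp only: of_real_0)
      show ?thesis
      proof (rule weak_limit_representable)
        show "fun_smult (cnj (1 / h n)) (g (w + axis i (h n)) - g w) \<in> H" for n
          using g(1) w h(2) by (simp add: H_scale H_diff)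
        show "(\<lambda>n. ip f (fun_smult (cnj (1 / h n)) (g (w + axis i (h n)) - g w)))
            \<longlonglongrightarrow> partial_deriv i (F f) w" if f: "f \<in> H" for f
          using partial_deriv_limit[of \<Omega> "F f" w h i] F f w h h_lim g
          by (simp add: ip_scale_right ip_diff_right H_diff)
      qed
    qed
    then show "(\<forall>f\<in>H. sep_holomorphic \<Omega> ((partial_deriv i \<circ> F) f)) \<and>
        (\<forall>w\<in>\<Omega>. \<exists>g\<in>H. \<forall>f\<in>H. (partial_deriv i \<circ> F) f w = ip f g)"
      using F \<Omega> by (simp add: sep_holomorphic_partial_deriv)
  qed
  then show ?thesis using w by blast
qed

text \<open>
  Let \<open>g\<close> represent \<open>f \<mapsto> (\<partial>\<^sup>\<alpha> f)(w)\<close>. Applying this to \<open>f = K(\<cdot>, z)\<close> gives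
  \<open>g z = ip g K(\<cdot>, z) = cnj ((\<partial>\<^sup>\<alpha> K(\<cdot>, z))(w))\<close>, and by the symmetry \<open>K(z, w) = cnj (K(w, z))\<close> the
  right-hand side is the conjugate derivative of \<open>K(z, \<cdot>)\<close> at \<open>w\<close>.
\<close>

lemma kernel_multi_deriv_represents:
  fixes \<Omega> :: "(complex^('m::{finite,linorder})) set"
  assumes hol: "holomorphic_hilbert_space \<Omega> H ip" and \<Omega>: "open \<Omega>"
    and K: "reproducing_kernel \<Omega> H ip K" and w: "w \<in> \<Omega>"
  shows "(\<lambda>z. multi_deriv dbar \<alpha> (K z) w) \<in> H \<and>
    (\<forall>f\<in>H. ip f (\<lambda>z. multi_deriv dbar \<alpha> (K z) w) = multi_deriv partial_deriv \<alpha> f w)"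
proof -
  interpret hilbert_on fun_smult H ip
    by (rule holomorphic_hilbert_space_hilbert_on[OF hol])
  have KH: "(\<lambda>z. K z u) \<in> H" "\<And>f. f \<in> H \<Longrightarrow> ip f (\<lambda>z. K z u) = f u" if "u \<in> \<Omega>" for u
    using K that unfolding reproducing_kernel_def by blast+
  note H_hol = holomorphic_hilbert_space_functions[OF hol]
  obtain g where g: "g \<in> H" "\<And>f. f \<in> H \<Longrightarrow> multi_deriv partial_deriv \<alpha> f w = ip f g"
    using derivative_representable[OF hol \<Omega> K w] by blast
  have "multi_deriv dbar \<alpha> (K z) w = g z" for z
  proof (cases "z \<in> \<Omega>")
    case True
    have "K z u = cnj (K u z)" if "u \<in> \<Omega>" for u
      using ip_commute[OF KH(1)[OF True] KH(1)[OF that]] KH(2)[OF True KH(1)[OF that]]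
        KH(2)[OF that KH(1)[OF True]] by simp
    then have "multi_deriv dbar \<alpha> (K z) w = cnj (multi_deriv partial_deriv \<alpha> (\<lambda>u. K u z) w)"
      by (rule multi_deriv_dbar_cnj[OF H_hol(1)[OF KH(1)[OF True]] \<Omega> w])
    then show ?thesis
      using g KH[OF True] ip_commute[OF KH(1)[OF True] g(1)] by simp
  next
    case False
    \<comment> \<open>Off \<open>\<Omega>\<close> all functions of the space vanish, so \<open>K z w = 0\<close> for \<open>z \<notin> \<Omega>\<close> and \<open>w \<in> \<Omega>\<close>.\<close>
    have "multi_deriv partial_deriv \<alpha> (\<lambda>_. 0) = (\<lambda>_ :: (complex, 'm) vec. 0)"
      by (rule multi_deriv_ind[of "\<lambda>F. F (\<lambda>_. 0) = (\<lambda>_. 0)"]) (auto simp: partial_deriv_def fun_eq_iff)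
    moreover have "multi_deriv dbar \<alpha> (K z) w = cnj (multi_deriv partial_deriv \<alpha> (\<lambda>_. 0) w)"
      by (rule multi_deriv_dbar_cnj[OF _ \<Omega> w])
         (use H_hol(2)[OF KH(1)] False in \<open>auto simp: sep_holomorphic_def\<close>)
    ultimately show ?thesis using H_hol(2)[OF g(1) False] by simp
  qed
  then show ?thesis using g by simp
qed

text \<open>
  The coefficients of \<open>q\<close> are conjugated twice, once by the star and once by the inner product, and so come out
  unchanged.
\<close>

lemma kernel_deriv_represents:
  fixes \<Omega> :: "(complex^('m::{finite,linorder})) set"
  assumes hol: "holomorphic_hilbert_space \<Omega> H ip" and \<Omega>: "open \<Omega>"
    and K: "reproducing_kernel \<Omega> H ip K" and w: "w \<in> \<Omega>"
  shows "kernel_deriv (mp_star q) K w \<in> H \<and>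
    (\<forall>f\<in>H. ip f (kernel_deriv (mp_star q) K w) = mp_lin (\<lambda>\<alpha>. multi_deriv partial_deriv \<alpha> f w) q)"
proof -
  interpret hilbert_on fun_smult H ip
    by (rule holomorphic_hilbert_space_hilbert_on[OF hol])
  define k where "k \<alpha> = (\<lambda>z. multi_deriv dbar \<alpha> (K z) w)" for \<alpha>
  have k: "k \<alpha> \<in> H" "f \<in> H \<Longrightarrow> ip f (k \<alpha>) = multi_deriv partial_deriv \<alpha> f w" for \<alpha> f
    using kernel_multi_deriv_represents[OF assms, of \<alpha>] by (auto simp: k_def)
  have star: "Poly_Mapping.lookup (mp_star q) \<alpha> = cnj (Poly_Mapping.lookup q \<alpha>)" for \<alpha>
    by (auto simp: mp_star_def map.rep_eq when_def)
  then have keys: "Poly_Mapping.keys (mp_star q) = Poly_Mapping.keys q"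
    by (auto simp: in_keys_iff)
  have sum_apply: "(\<Sum>\<alpha>\<in>A. F \<alpha>) z = (\<Sum>\<alpha>\<in>A. F \<alpha> z)"
    for A and F :: "('m \<Rightarrow>\<^sub>0 nat) \<Rightarrow> (complex, 'm) vec \<Rightarrow> complex" and z
    by (induction A rule: infinite_finite_induct) auto
  have eq: "kernel_deriv (mp_star q) K w =
      (\<Sum>\<alpha>\<in>Poly_Mapping.keys q. fun_smult (cnj (Poly_Mapping.lookup q \<alpha>)) (k \<alpha>))"
    by (simp add: fun_eq_iff sum_apply kernel_deriv_def dbar_op_def keys star fun_smult_def k_def)
  show ?thesis
    unfolding eq mp_lin_def
    by (auto simp: sum_scale_mem ip_sum_scale_right k intro!: sum.cong)
qed

lemma mult_op_mp_fun:
  "mult_op j (mp_fun \<Omega> p) - fun_smult (w $ j) (mp_fun \<Omega> p) = mp_fun \<Omega> (shifted_var w j * p)"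
  by (auto simp: fun_eq_iff mult_op_def fun_smult_def mp_fun_def mp_eval_mult algebra_simps)

text \<open>
  Membership in the joint kernel is orthogonality to the ranges of the operators \<open>M\<^sub>j - w\<^sub>j\<close>, and these need only be
  applied to the dense ideal \<open>I\<close>, where they act as multiplication of polynomials.
\<close>

lemma joint_kernel_eq:
  fixes \<Omega> :: "(complex^('m::{finite,linorder})) set"
  assumes module: "hilbert_module \<Omega> H ip" and dense: "completion_of_ideal \<Omega> I H ip"
  shows "joint_kernel H ip w =
    {g \<in> H. \<forall>j. \<forall>p\<in>I. ip (mp_fun \<Omega> (shifted_var w j * p)) g = 0}"
proof -
  have hol: "holomorphic_hilbert_space \<Omega> H ip"
    and mult: "\<And>j f. f \<in> H \<Longrightarrow> mult_op j f \<in> H"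
    and bdd: "\<And>j. \<exists>C. \<forall>f\<in>H. hnorm ip (mult_op j f) \<le> C * hnorm ip f"
    using module unfolding hilbert_module_def by blast+
  interpret hilbert_on fun_smult H ip
    by (rule holomorphic_hilbert_space_hilbert_on[OF hol])
  have "hadjoint H ip (\<lambda>f. mult_op j f - fun_smult (w $ j) f) g = 0 \<longleftrightarrow>
      (\<forall>p\<in>mp_fun \<Omega> ` I. ip (mult_op j p - fun_smult (w $ j) p) g = 0)"
    if g: "g \<in> H" for g j
  proof -
    obtain C where C: "\<And>f. f \<in> H \<Longrightarrow> nrm (mult_op j f) \<le> C * nrm f" using bdd[of j] by blast
    show ?thesis
    proof (rule hadjoint_eq_zero_iff)
      fix f assume f: "f \<in> H"
      have "nrm (mult_op j f - fun_smult (w $ j) f) \<le> nrm (mult_op j f) + nrm (fun_smult (w $ j) f)"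
        using nrm_triangle_diff[of "mult_op j f" 0 "fun_smult (w $ j) f"]
          nrm_minus_commute[of 0 "fun_smult (w $ j) f"] mult[OF f] H_scale[OF f] H_zero by simp
      also have "\<dots> \<le> (C + cmod (w $ j)) * nrm f"
        using C[OF f] nrm_scale[OF f] by (simp add: algebra_simps)
      finally show "nrm (mult_op j f - fun_smult (w $ j) f) \<le> (C + cmod (w $ j)) * nrm f" .
    next
      show "mult_op j f - fun_smult (w $ j) f \<in> H" if "f \<in> H" for f
        by (intro H_diff mult H_scale that)
    next
      show "mult_op j (f + f') - fun_smult (w $ j) (f + f') =
          mult_op j f - fun_smult (w $ j) f + (mult_op j f' - fun_smult (w $ j) f')" for f f'
        by (rule ext) (simp add: mult_op_def fun_smult_def algebra_simps)
    next
      show "mult_op j (fun_smult c f) - fun_smult (w $ j) (fun_smult c f) =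
          fun_smult c (mult_op j f - fun_smult (w $ j) f)" for c f
        by (rule ext) (simp add: mult_op_def fun_smult_def algebra_simps)
    qed (use dense g in \<open>auto simp: completion_of_ideal_def\<close>)
  qed
  then show ?thesis
    unfolding joint_kernel_def by (auto simp: mult_op_mp_fun)
qed


section \<open>The joint kernel and the characteristic spaces\<close>

text \<open>
  The cosets of \<open>V\<close> are the fibres of \<open>G\<close>, so \<open>G\<close> induces a conjugate-linear bijection of \<open>U / V\<close> onto
  \<open>N\<close>. Conjugating coefficients permutes the coefficient vectors, hence it preserves independence and span.
\<close>

lemma basis_iff_quotient_basis:
  fixes G :: "'a::ab_group_add \<Rightarrow> 'b::ab_group_add"
  assumes s1: "vector_space s1" and V: "module.subspace s1 V" 
    and add: "\<And>u v. G (u + v) = G u + G v"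
    and scale: "\<And>c u. G (s1 c u) = s2 (cnj c) (G u)"
    and kernel: "\<And>u. G u = 0 \<longleftrightarrow> u \<in> V"
    and mem: "\<And>u. G u \<in> N \<longleftrightarrow> u \<in> U" and surj: "N \<subseteq> range G"
  shows "is_basis s2 N t (\<lambda>i. G (v i)) \<longleftrightarrow> is_quotient_basis s1 U V t v"
proof -
  interpret vector_space s1 by (rule s1)
  have G0: "G 0 = 0" using kernel subspace_0[OF V] by simp
  have Gdiff: "G (u - u') = G u - G u'" for u u' using add[of "u - u'" u'] by (simp add: algebra_simps)
  have lc: "lincomb s2 t (\<lambda>i. G (v i)) c = G (lincomb s1 t v (\<lambda>i. cnj (c i)))" for c
    unfolding lincomb_def by (induction t) (auto simp: G0 add scale)
  have coset: "u +o V = u' +o V \<longleftrightarrow> G u = G u'" for u u'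
  proof -
    have "u +o V = u' +o V \<longleftrightarrow> u - u' \<in> V"
    proof
      assume "u +o V = u' +o V"
      moreover have "u \<in> u +o V" using subspace_0[OF V] by (force simp: elt_set_plus_def)
      ultimately show "u - u' \<in> V" by (auto simp: elt_set_plus_def)
    next
      assume uu': "u - u' \<in> V"
      have sub: "a +o V \<subseteq> b +o V" if "a - b \<in> V" for a b
      proof
        fix x assume "x \<in> a +o V"
        then obtain y where y: "y \<in> V" "x = a + y" by (auto simp: elt_set_plus_def)
        then have "x = b + ((a - b) + y)" by simp
        with subspace_add[OF V that y(1)] show "x \<in> b +o V" unfolding elt_set_plus_def by blast
      qed
      show "u +o V = u' +o V"
        using sub[of u u'] sub[of u' u] uu' subspace_neg[OF V uu'] by auto
    qed
    then show ?thesis using kernel[of "u - u'"] by (simp add: Gdiff)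
  qed
  have indep: "(\<forall>c. lincomb s2 t (\<lambda>i. G (v i)) c = 0 \<longrightarrow> (\<forall>i<t. c i = 0)) \<longleftrightarrow>
      (\<forall>c. lincomb s1 t v c +o V = 0 +o V \<longrightarrow> (\<forall>i<t. c i = 0))" (is "?L \<longleftrightarrow> ?R")
  proof
    assume L: ?L
    show ?R
    proof (intro allI impI)
      fix c i assume "lincomb s1 t v c +o V = 0 +o V" "i < t"
      then show "c i = 0" using L[rule_format, of "\<lambda>i. cnj (c i)" i] unfolding coset lc G0 by simp
    qed
  next
    assume R: ?R
    show ?L
    proof (intro allI impI)
      fix c i assume "lincomb s2 t (\<lambda>i. G (v i)) c = 0" "i < t"
      then show "c i = 0" using R[rule_format, of "\<lambda>i. cnj (c i)" i] unfolding coset lc G0 by simp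
    qed
  qed
  have "N = G ` U" using mem surj by blast
  moreover have "range (lincomb s2 t (\<lambda>i. G (v i))) = G ` range (lincomb s1 t v)"
  proof (intro equalityI subsetI)
    fix x assume "x \<in> G ` range (lincomb s1 t v)"
    then obtain c where "x = G (lincomb s1 t v c)" by blast
    then have "x = lincomb s2 t (\<lambda>i. G (v i)) (\<lambda>i. cnj (c i))" by (simp add: lc)
    then show "x \<in> range (lincomb s2 t (\<lambda>i. G (v i)))" by blast
  qed (auto simp: lc)
  moreover have "G ` U = G ` range (lincomb s1 t v) \<longleftrightarrow>
      quotient_space U V = range (\<lambda>c. lincomb s1 t v c +o V)"
  proof -
    have "G ` X \<subseteq> G ` Y \<longleftrightarrow> (\<lambda>u. u +o V) ` X \<subseteq> (\<lambda>u. u +o V) ` Y" for X Y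
      unfolding image_subset_iff image_iff coset ..
    then have "G ` U = G ` range (lincomb s1 t v) \<longleftrightarrow>
        (\<lambda>u. u +o V) ` U = (\<lambda>u. u +o V) ` range (lincomb s1 t v)"
      by (simp only: set_eq_subset)
    then show ?thesis by (simp only: quotient_space_def image_image)
  qed
  ultimately show ?thesis
    unfolding is_basis_def is_quotient_basis_def mem indep by simp
qed

theorem lemma2p1:
  fixes \<Omega> :: "(complex^('m::{finite,linorder})) set"
    and I :: "'m mpol set"
    and H :: "(complex^('m::{finite,linorder}) \<Rightarrow> complex) set"
    and ip :: "(complex^('m::{finite,linorder}) \<Rightarrow> complex) \<Rightarrow> (complex^('m::{finite,linorder}) \<Rightarrow> complex) \<Rightarrow> complex"
    and K :: "complex^('m::{finite,linorder}) \<Rightarrow> complex^('m::{finite,linorder}) \<Rightarrow> complex"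
    and w0 :: "complex^('m::{finite,linorder})"
    and q :: "nat \<Rightarrow> 'm mpol"
    and t :: nat
  assumes "bounded_domain \<Omega>"
    and "mp_ideal I"
    and "class_B1 \<Omega> H ip"
    and "completion_of_ideal \<Omega> I H ip"
    and "reproducing_kernel \<Omega> H ip K"
    and "w0 \<in> \<Omega>"
  shows "is_basis fun_smult (joint_kernel H ip w0) t (\<lambda>i. kernel_deriv (mp_star (q i)) K w0) \<longleftrightarrow>
         is_quotient_basis mp_smult (char_space_tilde w0 I) (char_space w0 I) t q"
proof -
  have \<Omega>: "open \<Omega>" using assms(1) by (simp add: bounded_domain_def)
  have module: "hilbert_module \<Omega> H ip" using assms(3) by (simp add: class_B1_def)
  then have hol: "holomorphic_hilbert_space \<Omega> H ip" by (simp add: hilbert_module_def)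
  interpret hilbert_on fun_smult H ip
    by (rule holomorphic_hilbert_space_hilbert_on[OF hol])
  have funH: "mp_fun \<Omega> p \<in> H" if "p \<in> I" for p
    using assms(4) that by (auto simp: completion_of_ideal_def)
  have dense: "\<exists>p\<in>mp_fun \<Omega> ` I. nrm (f - p) < e" if "f \<in> H" "e > 0" for f e
    using assms(4) that by (auto simp: completion_of_ideal_def)
  have Imult: "r * p \<in> I" if "p \<in> I" for r p using assms(2) that by (simp add: mp_ideal_def)
  define G where "G q = kernel_deriv (mp_star q) K w0" for q
  have GH: "G q \<in> H" for q
    using kernel_deriv_represents[OF hol \<Omega> assms(5,6)] by (simp add: G_def)
  have Gip: "ip (mp_fun \<Omega> p) (G q) = diff_pairing w0 q p" if "p \<in> I" for p q
    using kernel_deriv_represents[OF hol \<Omega> assms(5,6), of q] funH[OF that]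
    by (simp add: G_def diff_pairing_eq_lin multi_deriv_mp_fun[OF \<Omega> assms(6)])
  have zeroI: "h = 0" if h: "h \<in> H" and "\<And>p. p \<in> I \<Longrightarrow> ip (mp_fun \<Omega> p) h = 0" for h
    by (rule ip_separates[OF h], rule ip_eq_zero_of_dense[of "mp_fun \<Omega> ` I"])
       (use that funH dense in auto)
  have eqI: "h = h'" if "h \<in> H" "h' \<in> H" "\<And>p. p \<in> I \<Longrightarrow> ip (mp_fun \<Omega> p) h = ip (mp_fun \<Omega> p) h'" for h h'
    using zeroI[of "h - h'"] that funH by (simp add: H_diff ip_diff_right)
  have kernel: "G q = 0 \<longleftrightarrow> q \<in> char_space w0 I" for q
  proof -
    have "G q = 0 \<longleftrightarrow> (\<forall>p\<in>I. ip (mp_fun \<Omega> p) (G q) = 0)"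
      using zeroI[OF GH] funH by auto
    then show ?thesis by (simp add: Gip char_space_eq)
  qed
  have jk: "joint_kernel H ip w0 = {g \<in> H. \<forall>j. \<forall>p\<in>I. ip (mp_fun \<Omega> (shifted_var w0 j * p)) g = 0}"
    by (rule joint_kernel_eq[OF module assms(4)])
  have mem: "G q \<in> joint_kernel H ip w0 \<longleftrightarrow> q \<in> char_space_tilde w0 I" for q
    by (auto simp: jk GH Gip Imult diff_pairing_shifted_var_mult char_space_tilde_def char_space_eq)
  have surj: "joint_kernel H ip w0 \<subseteq> range G"
  proof
    fix g assume g: "g \<in> joint_kernel H ip w0"
    then have gH: "g \<in> H" by (simp add: jk)
    have "\<exists>q. \<forall>p\<in>I. ip (mp_fun \<Omega> p) g = diff_pairing w0 q p"
    proof (rule ideal_functional_eq_diff_pairing[OF assms(2)])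
      fix p p' assume p: "p \<in> I" "p' \<in> I"
      have "mp_fun \<Omega> (p + p') = mp_fun \<Omega> p + mp_fun \<Omega> p'"
        by (auto simp: mp_fun_def fun_eq_iff mp_eval_add)
      then show "ip (mp_fun \<Omega> (p + p')) g = ip (mp_fun \<Omega> p) g + ip (mp_fun \<Omega> p') g"
        using p funH gH by (simp add: ip_add_left)
    next
      fix c p assume p: "p \<in> I"
      have "mp_fun \<Omega> (mp_smult c p) = fun_smult c (mp_fun \<Omega> p)"
        by (auto simp: mp_fun_def fun_eq_iff mp_eval_smult fun_smult_def)
      then show "ip (mp_fun \<Omega> (mp_smult c p)) g = c * ip (mp_fun \<Omega> p) g"
        using p funH gH by (simp add: ip_scale_left)
    next
      show "ip (mp_fun \<Omega> (shifted_var w0 j * p)) g = 0" if "p \<in> I" for j p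
        using g that by (simp add: jk)
    qed
    then obtain q where "\<And>p. p \<in> I \<Longrightarrow> ip (mp_fun \<Omega> p) g = diff_pairing w0 q p" by blast
    then have "g = G q" by (intro eqI gH GH) (simp add: Gip)
    then show "g \<in> range G" by blast
  qed
  have "is_basis fun_smult (joint_kernel H ip w0) t (\<lambda>i. G (q i)) \<longleftrightarrow>
      is_quotient_basis mp_smult (char_space_tilde w0 I) (char_space w0 I) t q"
  proof (rule basis_iff_quotient_basis[OF mpol.vector_space_axioms _ _ _ kernel mem surj])
    show "mpol.subspace (char_space w0 I)"
      by (auto simp: mpol.subspace_def char_space_eq diff_pairing_zero_left
          diff_pairing_add_left diff_pairing_smult_left)
    show "G (u + v) = G u + G v" for u v
      by (intro eqI GH H_add) (simp_all add: Gip funH GH ip_add_right diff_pairing_add_left)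
    show "G (mp_smult c u) = fun_smult (cnj c) (G u)" for c u
      by (intro eqI GH H_scale) (simp_all add: Gip funH GH ip_scale_right diff_pairing_smult_left)
  qed
  then show ?thesis by (simp add: G_def)
qed

end
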